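(* Let $(X,d)$ be a metric space and let $\mathcal{B}$ be a bornology on $X$ with a closed base $\mathcal{B}_0$. Then the following statements are equivalent: (1) $\tau_{\mathcal{B}}=\tau_{\mathcal{B}}^s$ on $C(X)$; (2) $\mathcal{B}$ is shielded from closed sets; (3) $(C(X),\tau_{\mathcal{B}})^*=(C(X),\tau_{\mathcal{B}}^s)^*$.
   Context: $C(X)$ is the real vector space of continuous functions $X\to\mathbb{R}$. A bornology $\mathcal{B}$ on $X$ is a collection of non-empty subsets of $X$ that covers $X$ and is closed under finite unions and under taking (non-empty) subsets of its members. A closed base is a subfamily $\mathcal{B}_0\subseteq\mathcal{B}$ of closed sets such that every member of $\mathcal{B}$ is contained in a member of $\mathcal{B}_0$. For $B\subseteq X$ and $\delta>0$, $B^\delta=\bigcup_{y\in B}\{x\in X:d(x,y)<\delta\}$. For $B\in\mathcal{B}$ and $f\in C(X)$ let $\rho_B(f)=\sup_{x\in B}|f(x)|\in[0,\infty]$ and $\rho_B^s(f)=\inf_{\delta>0}\sup_{x\in B^\delta}|f(x)|\in[0,\infty]$. $\tau_{\mathcal{B}}$ (uniform convergence on $\mathcal{B}$), respectively $\tau_{\mathcal{B}}^s$ (strong uniform convergence on $\mathcal{B}$), is the translation-invariant topology on $C(X)$ for which the sets $\rho_B^{-1}([0,r))$, respectively $(\rho_B^s)^{-1}([0,r))$ ($B\in\mathcal{B}$, $r>0$), form a neighborhood base at $0$. A superscript $*$ denotes the space of all continuous linear functionals into $\mathbb{R}$. A superset $A_1$ of $A\subseteq X$ is a shield for $A$ if for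 every non-empty closed $C\subseteq X$ with $C\cap A_1=\emptyset$ there is $\delta>0$ with $C\cap A^\delta=\emptyset$. $\mathcal{B}$ is shielded from closed sets if every member of $\mathcal{B}$ has a closed shield belonging to $\mathcal{B}$. *)

theory Defs
  imports "HOL-Analysis.Analysis"
begin

typedef (overloaded) 'a cfun = "{f :: 'a::topological_space \<Rightarrow> real. continuous_on UNIV f}"
  morphisms cf_app Cfun
  by (rule exI[of _ "\<lambda>_. 0"]) simp

setup_lifting type_definition_cfun

instantiation cfun :: (topological_space) real_vector
begin

lift_definition zero_cfun :: "'a cfun" is "\<lambda>_. 0" by simp
lift_definition plus_cfun :: "'a cfun \<Rightarrow> 'a cfun \<Rightarrow> 'a cfun" is "\<lambda>f g x. f x + g x"
  by (intro continuous_intros)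
lift_definition uminus_cfun :: "'a cfun \<Rightarrow> 'a cfun" is "\<lambda>f x. - f x"
  by (intro continuous_intros)
lift_definition minus_cfun :: "'a cfun \<Rightarrow> 'a cfun \<Rightarrow> 'a cfun" is "\<lambda>f g x. f x - g x"
  by (intro continuous_intros)
lift_definition scaleR_cfun :: "real \<Rightarrow> 'a cfun \<Rightarrow> 'a cfun" is "\<lambda>c f x. c * f x"
  by (intro continuous_intros)

instance
  by standard (transfer; auto simp: algebra_simps)+

end

definition bornology :: "'a set set \<Rightarrow> bool" where
  "bornology \<B> \<longleftrightarrow> {} \<notin> \<B> \<and> \<Union>\<B> = UNIV \<and> (\<forall>A\<in>\<B>. \<forall>B\<in>\<B>. A \<union> B \<in> \<B>) \<and>
     (\<forall>B\<in>\<B>. \<forall>A. A \<subseteq> B \<and> A \<noteq> {} \<longrightarrow> A \<in> \<B>)"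

definition closed_base :: "'a::topological_space set set \<Rightarrow> 'a set set \<Rightarrow> bool" where
  "closed_base \<B>0 \<B> \<longleftrightarrow> \<B>0 \<subseteq> \<B> \<and> (\<forall>B\<in>\<B>0. closed B) \<and> (\<forall>B\<in>\<B>. \<exists>B0\<in>\<B>0. B \<subseteq> B0)"

definition enlargement :: "'a::metric_space set \<Rightarrow> real \<Rightarrow> 'a set" where
  "enlargement B \<delta> = (\<Union>y\<in>B. {x. dist x y < \<delta>})"

definition shield :: "'a::metric_space set \<Rightarrow> 'a set \<Rightarrow> bool" where
  "shield A1 A \<longleftrightarrow> A \<subseteq> A1 \<and>
     (\<forall>C. C \<noteq> {} \<and> closed C \<and> C \<inter> A1 = {} \<longrightarrow> (\<exists>\<delta>>0. C \<inter> enlargement A \<delta> = {}))"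

definition shielded_from_closed :: "'a::metric_space set set \<Rightarrow> bool" where
  "shielded_from_closed \<B> \<longleftrightarrow> (\<forall>A\<in>\<B>. \<exists>A1\<in>\<B>. closed A1 \<and> shield A1 A)"

text \<open>The only candidate for a translation-invariant topology with neighborhood base \<open>N\<close> at
  \<open>0\<close>; see \<open>transl_topology_unique\<close>. It is meaningful only under \<open>nhd_filter_base N\<close>, since otherwise
  the argument of \<^term>\<open>topology\<close> need not satisfy the axioms of a topology.\<close>

definition transl_topology :: "'v::ab_group_add set set \<Rightarrow> 'v topology" where
  "transl_topology N = topology (\<lambda>U. \<forall>f\<in>U. \<exists>V\<in>N. \<forall>v\<in>V. f + v \<in> U)"

definition nhd_filter_base :: "'v::ab_group_add set set \<Rightarrow> bool" where
  "nhd_filter_base N \<longleftrightarrow> N \<noteq> {} \<and> (\<forall>V\<in>N. \<forall>W\<in>N. \<exists>Z\<in>N. Z \<subseteq> V \<inter> W) \<and>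
     (\<forall>V\<in>N. 0 \<in> V) \<and> (\<forall>V\<in>N. \<forall>v\<in>V. \<exists>W\<in>N. \<forall>w\<in>W. v + w \<in> V)"

lemma openin_transl_topology:
  assumes N: "nhd_filter_base N"
  shows "openin (transl_topology N) U \<longleftrightarrow> (\<forall>f\<in>U. \<exists>V\<in>N. \<forall>v\<in>V. f + v \<in> U)"
proof -
  have "istopology (\<lambda>U. \<forall>f\<in>U. \<exists>V\<in>N. \<forall>v\<in>V. f + v \<in> U)"
    unfolding istopology_def
  proof (intro conjI allI impI ballI)
    fix S T f
    assume S: "\<forall>f\<in>S. \<exists>V\<in>N. \<forall>v\<in>V. f + v \<in> S" and T: "\<forall>f\<in>T. \<exists>V\<in>N. \<forall>v\<in>V. f + v \<in> T"
      and f: "f \<in> S \<inter> T"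
    obtain V where V: "V \<in> N" "\<forall>v\<in>V. f + v \<in> S" using S f by (meson IntD1)
    obtain W where W: "W \<in> N" "\<forall>v\<in>W. f + v \<in> T" using T f by (meson IntD2)
    obtain Z where Z: "Z \<in> N" "Z \<subseteq> V \<inter> W" using N V(1) W(1) unfolding nhd_filter_base_def by meson
    have "\<forall>v\<in>Z. f + v \<in> S \<inter> T" using V(2) W(2) Z(2) by auto
    with Z(1) show "\<exists>V\<in>N. \<forall>v\<in>V. f + v \<in> S \<inter> T" by (rule bexI[rotated])
  next
    fix K f
    assume K: "\<forall>S\<in>K. \<forall>f\<in>S. \<exists>V\<in>N. \<forall>v\<in>V. f + v \<in> S" and f: "f \<in> \<Union>K"
    obtain S where S: "S \<in> K" "f \<in> S" using f by (elim UnionE)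
    obtain V where V: "V \<in> N" "\<forall>v\<in>V. f + v \<in> S" using bspec[OF bspec[OF K S(1)] S(2)] by (elim bexE)
    have "\<forall>v\<in>V. f + v \<in> \<Union>K" using V(2) S(1) by auto
    with V(1) show "\<exists>V\<in>N. \<forall>v\<in>V. f + v \<in> \<Union>K" by (rule bexI[rotated])
  qed
  then show ?thesis by (simp add: transl_topology_def topology_inverse')
qed

lemma topspace_transl_topology:
  assumes N: "nhd_filter_base N"
  shows "topspace (transl_topology N) = UNIV"
proof -
  have "openin (transl_topology N) UNIV"
    using N unfolding openin_transl_topology[OF N] nhd_filter_base_def by auto
  then show ?thesis by (simp add: openin_subset top.extremum_uniqueI)
qed

lemma transl_topology_translation:
  assumes N: "nhd_filter_base N"
    and U: "openin (transl_topology N) U"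
  shows "openin (transl_topology N) ((+) f ` U)"
  unfolding openin_transl_topology[OF N]
proof
  fix h assume "h \<in> (+) f ` U"
  then obtain u where u: "u \<in> U" "h = f + u" by (elim imageE)
  have "\<exists>V\<in>N. \<forall>v\<in>V. u + v \<in> U"
    using U u(1) unfolding openin_transl_topology[OF N] by (rule bspec)
  then obtain V where V: "V \<in> N" "\<forall>v\<in>V. u + v \<in> U" by (elim bexE)
  have "\<forall>v\<in>V. h + v \<in> (+) f ` U" using V(2) by (simp add: u(2) add.assoc)
  with V(1) show "\<exists>V\<in>N. \<forall>v\<in>V. h + v \<in> (+) f ` U" by (rule bexI[rotated])
qed

lemma transl_topology_nhd_base:
  assumes N: "nhd_filter_base N"
  shows "(\<exists>U. openin (transl_topology N) U \<and> 0 \<in> U \<and> U \<subseteq> W) \<longleftrightarrow> (\<exists>V\<in>N. V \<subseteq> W)"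
proof
  assume "\<exists>U. openin (transl_topology N) U \<and> 0 \<in> U \<and> U \<subseteq> W"
  then obtain U where U: "\<forall>f\<in>U. \<exists>V\<in>N. \<forall>v\<in>V. f + v \<in> U" "0 \<in> U" "U \<subseteq> W"
    unfolding openin_transl_topology[OF N] by (elim exE conjE)
  obtain V where "V \<in> N" "\<forall>v\<in>V. 0 + v \<in> U" using bspec[OF U(1,2)] by (elim bexE)
  then show "\<exists>V\<in>N. V \<subseteq> W" using U(3) by auto
next
  assume "\<exists>V\<in>N. V \<subseteq> W"
  then obtain V where V: "V \<in> N" "V \<subseteq> W" by (elim bexE)
  then have "openin (transl_topology N) V"
    unfolding openin_transl_topology[OF N] using N by (simp add: nhd_filter_base_def)
  then show "\<exists>U. openin (transl_topology N) U \<and> 0 \<in> U \<and> U \<subseteq> W"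
    using V N by (intro exI[of _ V] conjI) (auto simp: nhd_filter_base_def)
qed

lemma transl_topology_unique:
  assumes transl: "\<And>f U. openin T U \<Longrightarrow> openin T ((+) f ` U)"
    and base: "\<And>W. (\<exists>U. openin T U \<and> 0 \<in> U \<and> U \<subseteq> W) \<longleftrightarrow> (\<exists>V\<in>N. V \<subseteq> W)"
  shows "T = transl_topology N"
proof -
  have "openin T U \<longleftrightarrow> (\<forall>f\<in>U. \<exists>V\<in>N. \<forall>v\<in>V. f + v \<in> U)" for U
  proof (intro iffI ballI)
    fix f assume U: "openin T U" and f: "f \<in> U"
    have "0 \<in> (+) (-f) ` U" using f by (intro image_eqI[of _ _ f]) auto
    then have "\<exists>V\<in>N. V \<subseteq> (+) (-f) ` U"
      using transl[OF U, of "-f"] by (intro iffD1[OF base]) auto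
    then obtain V where V: "V \<in> N" "V \<subseteq> (+) (-f) ` U" by (elim bexE)
    have "f + v \<in> U" if v: "v \<in> V" for v
    proof -
      obtain u where "u \<in> U" "v = -f + u" using subsetD[OF V(2) v] by (elim imageE)
      then show ?thesis by simp
    qed
    with V(1) show "\<exists>V\<in>N. \<forall>v\<in>V. f + v \<in> U" by (intro bexI[of _ V] ballI)
  next
    assume R: "\<forall>f\<in>U. \<exists>V\<in>N. \<forall>v\<in>V. f + v \<in> U"
    have "\<exists>S. openin T S \<and> f \<in> S \<and> S \<subseteq> U" if f: "f \<in> U" for f
    proof -
      obtain V where V: "V \<in> N" "\<forall>v\<in>V. f + v \<in> U" using bspec[OF R f] by (elim bexE)
      have "\<exists>Q. openin T Q \<and> 0 \<in> Q \<and> Q \<subseteq> V" using V(1) by (intro iffD2[OF base]) auto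
      then obtain Q where Q: "openin T Q" "0 \<in> Q" "Q \<subseteq> V" by (elim exE conjE)
      have "openin T ((+) f ` Q)" by (rule transl[OF Q(1)])
      moreover have "f \<in> (+) f ` Q" using Q(2) by (intro image_eqI[of _ _ 0]) auto
      moreover have "(+) f ` Q \<subseteq> U"
      proof (rule image_subsetI)
        fix x assume "x \<in> Q"
        then show "f + x \<in> U" using Q(3) V(2) by (simp add: subset_iff)
      qed
      ultimately show ?thesis by (intro exI[of _ "(+) f ` Q"] conjI)
    qed
    then show "openin T U" by (subst openin_subopen) (intro ballI)
  qed
  then have "openin T = (\<lambda>U. \<forall>f\<in>U. \<exists>V\<in>N. \<forall>v\<in>V. f + v \<in> U)" by (intro ext)
  then have "topology (openin T) = transl_topology N" by (simp add: transl_topology_def)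
  then show ?thesis by (simp add: openin_inverse)
qed

definition rho :: "'a::topological_space set \<Rightarrow> 'a cfun \<Rightarrow> ennreal" where
  "rho B f = (SUP x\<in>B. ennreal \<bar>cf_app f x\<bar>)"

definition rho_s :: "'a::metric_space set \<Rightarrow> 'a cfun \<Rightarrow> ennreal" where
  "rho_s B f = (INF \<delta>\<in>{0<..}. SUP x\<in>enlargement B \<delta>. ennreal \<bar>cf_app f x\<bar>)"

definition tau :: "'a::topological_space set set \<Rightarrow> 'a cfun topology" where
  "tau \<B> = transl_topology {{f. rho B f < ennreal r} | B r. B \<in> \<B> \<and> 0 < r}"

definition tau_s :: "'a::metric_space set set \<Rightarrow> 'a cfun topology" where
  "tau_s \<B> = transl_topology {{f. rho_s B f < ennreal r} | B r. B \<in> \<B> \<and> 0 < r}"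

definition dual :: "'v::real_vector topology \<Rightarrow> ('v \<Rightarrow> real) set" where
  "dual T = {F. linear F \<and> continuous_map T euclideanreal F}"

text \<open>Both \<open>rho B\<close> and \<open>rho_s B\<close> are subadditive, vanish at \<open>0\<close> and are monotone in \<open>B\<close>, so
  \<^const>\<open>tau\<close> and \<^const>\<open>tau_s\<close> are indeed translation-invariant topologies with the stated
  neighborhood bases.\<close>

lemma rho_zero [simp]: "rho B 0 = 0"
  by (cases "B = {}") (simp_all add: rho_def zero_cfun.rep_eq bot_ennreal)

lemma rho_mono: "A \<subseteq> B \<Longrightarrow> rho A f \<le> rho B f"
  unfolding rho_def by (rule SUP_subset_mono) auto

lemma rho_add: "rho B (f + g) \<le> rho B f + rho B g"
  unfolding rho_def
proof (rule SUP_least)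
  fix x assume x: "x \<in> B"
  have "ennreal \<bar>cf_app (f + g) x\<bar> \<le> ennreal \<bar>cf_app f x\<bar> + ennreal \<bar>cf_app g x\<bar>"
    by (simp add: plus_cfun.rep_eq flip: ennreal_plus)
  also have "\<dots> \<le> (SUP x\<in>B. ennreal \<bar>cf_app f x\<bar>) + (SUP x\<in>B. ennreal \<bar>cf_app g x\<bar>)"
    using x by (intro add_mono SUP_upper)
  finally show "ennreal \<bar>cf_app (f + g) x\<bar> \<le> \<dots>" .
qed

lemma rho_s_eq: "rho_s B f = (INF \<delta>\<in>{0<..}. rho (enlargement B \<delta>) f)"
  by (simp add: rho_s_def rho_def)

lemma enlargement_mono: "A \<subseteq> B \<Longrightarrow> \<delta> \<le> \<epsilon> \<Longrightarrow> enlargement A \<delta> \<subseteq> enlargement B \<epsilon>"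
  unfolding enlargement_def by fastforce

lemma rho_s_zero [simp]: "rho_s B 0 = 0"
  by (simp add: rho_s_eq)

lemma rho_s_mono: "A \<subseteq> B \<Longrightarrow> rho_s A f \<le> rho_s B f"
  unfolding rho_s_eq by (intro INF_mono) (meson enlargement_mono order_refl rho_mono)

lemma rho_s_add: "rho_s B (f + g) \<le> rho_s B f + rho_s B g"
proof (rule ennreal_le_epsilon)
  fix e :: real assume fin: "rho_s B f + rho_s B g < top" and e: "0 < e"
  have *: "\<exists>\<delta>>0. rho (enlargement B \<delta>) h < rho_s B h + ennreal (e/2)" if "rho_s B h < top" for h
  proof -
    have "rho_s B h < rho_s B h + ennreal (e/2)"
      using that e ennreal_add_left_cancel_less[of "rho_s B h" 0 "ennreal (e/2)"] by simp
    then show ?thesis unfolding rho_s_eq[of B h] INF_less_iff by auto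
  qed
  obtain d1 d2 where d: "d1 > 0" "d2 > 0"
      "rho (enlargement B d1) f < rho_s B f + ennreal (e/2)"
      "rho (enlargement B d2) g < rho_s B g + ennreal (e/2)"
    using *[of f] *[of g] fin by auto
  let ?E = "enlargement B (min d1 d2)"
  have "rho_s B (f + g) \<le> rho ?E (f + g)"
    unfolding rho_s_eq using d by (intro INF_lower) auto
  also have "\<dots> \<le> rho ?E f + rho ?E g" by (rule rho_add)
  also have "\<dots> \<le> rho (enlargement B d1) f + rho (enlargement B d2) g"
    by (intro add_mono rho_mono enlargement_mono) auto
  also have "\<dots> \<le> (rho_s B f + ennreal (e/2)) + (rho_s B g + ennreal (e/2))"
    using d by (intro add_mono) auto
  also have "\<dots> = rho_s B f + rho_s B g + (ennreal (e/2) + ennreal (e/2))"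
    by (simp add: ac_simps)
  also have "ennreal (e/2) + ennreal (e/2) = ennreal e"
    using e by (simp flip: ennreal_plus)
  finally show "rho_s B (f + g) \<le> rho_s B f + rho_s B g + ennreal e" .
qed

lemma nhd_filter_base_balls:
  fixes p :: "'a set \<Rightarrow> 'v::ab_group_add \<Rightarrow> ennreal"
  assumes \<B>: "bornology \<B>"
    and zero: "\<And>B. p B 0 = 0"
    and mono: "\<And>A B f. A \<subseteq> B \<Longrightarrow> p A f \<le> p B f"
    and add: "\<And>B f g. p B (f + g) \<le> p B f + p B g"
  shows "nhd_filter_base {{f. p B f < ennreal r} | B r. B \<in> \<B> \<and> 0 < r}"
    (is "nhd_filter_base ?N")
  unfolding nhd_filter_base_def
proof (intro conjI ballI)
  have "\<B> \<noteq> {}" using \<B> by (auto simp: bornology_def)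
  then obtain B where "B \<in> \<B>" by auto
  then have "{f. p B f < ennreal 1} \<in> ?N" by (intro CollectI exI[of _ B] exI[of _ 1]) auto
  then show "?N \<noteq> {}" by auto
next
  fix V W assume "V \<in> ?N" "W \<in> ?N"
  then obtain A B r s where AB: "A \<in> \<B>" "B \<in> \<B>" "0 < r" "0 < s"
      and V: "V = {f. p A f < ennreal r}" and W: "W = {f. p B f < ennreal s}"
    by auto
  let ?Z = "{f. p (A \<union> B) f < ennreal (min r s)}"
  have "A \<union> B \<in> \<B>" using \<B> AB by (simp add: bornology_def)
  then have "?Z \<in> ?N" using AB by (intro CollectI exI[of _ "A \<union> B"] exI[of _ "min r s"]) auto
  moreover have "?Z \<subseteq> V \<inter> W"
  proof
    fix f assume "f \<in> ?Z"
    then have f: "p (A \<union> B) f < ennreal (min r s)" by simp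
    have "p A f \<le> p (A \<union> B) f" "p B f \<le> p (A \<union> B) f" by (auto intro: mono)
    moreover have "ennreal (min r s) \<le> ennreal r" "ennreal (min r s) \<le> ennreal s"
      by (auto intro: ennreal_leI)
    ultimately have "p A f < ennreal r" "p B f < ennreal s"
      using f by (meson order_le_less_trans order_less_le_trans)+
    then show "f \<in> V \<inter> W" by (simp add: V W)
  qed
  ultimately show "\<exists>Z\<in>?N. Z \<subseteq> V \<inter> W" by (rule bexI[rotated])
next
  fix V assume "V \<in> ?N" then show "0 \<in> V" by (auto simp: zero)
next
  fix V v assume "V \<in> ?N" "v \<in> V"
  then obtain B r where B: "B \<in> \<B>" "0 < r" "V = {f. p B f < ennreal r}" "p B v < ennreal r"
    by auto
  obtain s where s: "p B v = ennreal s" "0 \<le> s" "s < r"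
    using B(4) by (cases "p B v") (auto simp: ennreal_less_iff)
  have "\<forall>f\<in>{f. p B f < ennreal (r - s)}. v + f \<in> V"
  proof
    fix f assume "f \<in> {f. p B f < ennreal (r - s)}"
    then have f: "p B f < ennreal (r - s)" by simp
    have "p B (v + f) \<le> ennreal s + p B f" using add[of B v f] s by simp
    also have "\<dots> < ennreal s + ennreal (r - s)"
      using f by (simp add: ennreal_add_left_cancel_less)
    also have "\<dots> = ennreal r" using s by (simp flip: ennreal_plus)
    finally show "v + f \<in> V" using B by simp
  qed
  moreover have "{f. p B f < ennreal (r - s)} \<in> ?N"
    using B s by (intro CollectI exI[of _ B] exI[of _ "r - s"]) auto
  ultimately show "\<exists>W\<in>?N. \<forall>w\<in>W. v + w \<in> V" by (rule bexI)
qed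

lemma nhd_filter_base_rho:
  "bornology \<B> \<Longrightarrow> nhd_filter_base {{f. rho B f < ennreal r} | B r. B \<in> \<B> \<and> 0 < r}"
  by (rule nhd_filter_base_balls) (auto intro: rho_mono rho_add)

lemma nhd_filter_base_rho_s:
  "bornology \<B> \<Longrightarrow> nhd_filter_base {{f. rho_s B f < ennreal r} | B r. B \<in> \<B> \<and> 0 < r}"
  by (rule nhd_filter_base_balls) (auto intro: rho_s_mono rho_s_add)

lemma topspace_tau: "bornology \<B> \<Longrightarrow> topspace (tau \<B>) = UNIV"
  unfolding tau_def by (rule topspace_transl_topology[OF nhd_filter_base_rho])

lemma tau_translation:
  "bornology \<B> \<Longrightarrow> openin (tau \<B>) U \<Longrightarrow> openin (tau \<B>) ((+) f ` U)"
  unfolding tau_def by (rule transl_topology_translation[OF nhd_filter_base_rho])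

lemma tau_nhd_base:
  assumes "bornology \<B>"
  shows "(\<exists>U. openin (tau \<B>) U \<and> 0 \<in> U \<and> U \<subseteq> W) \<longleftrightarrow>
    (\<exists>B\<in>\<B>. \<exists>r>0. {f. rho B f < ennreal r} \<subseteq> W)"
  unfolding tau_def transl_topology_nhd_base[OF nhd_filter_base_rho[OF assms]] by auto

lemma topspace_tau_s: "bornology \<B> \<Longrightarrow> topspace (tau_s \<B>) = UNIV"
  unfolding tau_s_def by (rule topspace_transl_topology[OF nhd_filter_base_rho_s])

lemma tau_s_translation:
  "bornology \<B> \<Longrightarrow> openin (tau_s \<B>) U \<Longrightarrow> openin (tau_s \<B>) ((+) f ` U)"
  unfolding tau_s_def by (rule transl_topology_translation[OF nhd_filter_base_rho_s])

lemma tau_s_nhd_base: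
  assumes "bornology \<B>"
  shows "(\<exists>U. openin (tau_s \<B>) U \<and> 0 \<in> U \<and> U \<subseteq> W) \<longleftrightarrow>
    (\<exists>B\<in>\<B>. \<exists>r>0. {f. rho_s B f < ennreal r} \<subseteq> W)"
  unfolding tau_s_def transl_topology_nhd_base[OF nhd_filter_base_rho_s[OF assms]] by auto

end

theory Submission
  imports Defs
begin

text \<open>
  If \<open>A1\<close> is a shield of \<open>A\<close> and \<open>\<bar>f\<bar> < r / 2\<close> on \<open>A1\<close>, then the closed set \<open>{\<bar>f\<bar> \<ge> r / 2}\<close> misses
  \<open>A1\<close>, hence misses a whole enlargement of \<open>A\<close>; so a bornology shielded from closed sets
  yields the same topology twice (\<open>tau_eq_tau_s_of_shielded\<close>), and equal topologies have equal
  duals. The substance is that equal duals force shields.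

  Suppose that \<open>A \<in> \<B>\<close> has no closed shield in \<open>\<B>\<close>. It is enough to find one linear functional
  \<open>F\<close> that is continuous for \<^term>\<open>tau_s \<B>\<close> but not for \<^term>\<open>tau \<B>\<close>. Measure-like functionals,
  which are determined by the functions bounded near \<open>A\<close>, do not suffice in general: in the
  plane, let \<open>A\<close> be the \<open>x\<close>-axis and let \<open>\<B>\<close> be generated by the axis together
  with the sets \<open>{\<bar>y\<bar> \<ge> g x}\<close>, where
  \<open>g > 0\<close> is continuous. Countably many such \<open>g\<close> have a common minorant up to bounded parts of the
  plane, so every measure living at \<open>A\<close> is already carried by one member of \<open>\<B>\<close>. Therefore \<open>F\<close>
  is taken at the opposite extreme: it vanishes on every function bounded on some enlargement of
  \<open>A\<close>. Such an \<open>F\<close> is locally constant, hence continuous, for \<^term>\<open>tau_s \<B>\<close>, whatever its values on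
  the remaining functions are. On the other hand, if \<open>F\<close> is continuous for \<^term>\<open>tau \<B>\<close>, then some
  \<open>B \<in> \<B>\<close> has the property that \<open>F\<close> kills all functions vanishing on \<open>B\<close>; enlarging \<open>B\<close>, one may
  take it closed with \<open>A \<subseteq> B\<close>.

  Since \<open>B\<close> is no shield, there is a function \<open>f\<close> that vanishes on \<open>B\<close> and is unbounded near \<open>A\<close>
  (\<open>unshielded_unbounded_function\<close>). Say that \<open>h\<close> is dominated by \<open>f\<close> if near \<open>A\<close> the function \<open>h\<close>
  is bounded on each set \<open>{\<bar>f\<bar> \<le> k}\<close>. A function dominated by \<open>f\<close> differs from one vanishing on \<open>B\<close>
  only by a function bounded near \<open>A\<close> (\<open>dominated_approx_vanishing\<close>). So a contradiction arises as
  soon as \<open>F\<close> is nonzero at some function dominated by \<open>f\<close>, and it remains to find an \<open>F\<close> that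
  achieves this for all \<open>f\<close> unbounded near \<open>A\<close> at once (\<open>functional_detecting_unbounded\<close>).

  That is a dimension count. Work modulo the functions bounded near \<open>A\<close>, and let \<open>U f\<close> be the
  space of functions dominated by \<open>f\<close>. Domination is transitive, so \<open>U g \<subseteq> U f\<close> for \<open>g \<in> U f\<close>, and
  every nonzero \<open>U f\<close> has dimension at least that of the continuum, because it contains the
  functions \<open>exp (c * \<bar>f\<bar>)\<close> with \<open>c > 0\<close>, which are independent (\<open>exp_abs_independent\<close>).
  Call \<open>f\<close> homogeneous if all nonzero \<open>U g\<close> with \<open>g \<in> U f\<close> have the same dimension \<open>\<kappa>\<close>; cardinals being well-ordered, there are homogeneous functions below every \<open>f\<close>.
  As \<open>\<kappa>\<close> is at least the continuum, such a \<open>U f\<close> has just \<open>\<kappa>\<close> elements, and transfinite recursion of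
  length \<open>\<kappa>\<close> picks from each of these \<open>U g\<close> one vector, all of them linearly independent
  (\<open>independent_transversal\<close>). Doing this below each member of a maximal family of homogeneous
  functions with pairwise disjoint \<open>U f\<close> again gives an independent set, since the sum of disjoint
  \<open>U f\<close> is direct (\<open>dominated_disjoint_sums\<close>). Let \<open>F\<close> be \<open>1\<close> on that set.
\<close>

section \<open>Cardinalities of spans and independent sets\<close>

unbundle cardinal_syntax

lemma finite_card_of_le_infinite:
  assumes "finite A" "infinite B"
  shows "|A| \<le>o |B|"
  using disjE[OF ordLeq_total[OF card_of_Well_order card_of_Well_order, of A B]]
    card_of_ordLeq_finite[of B A] assms by blast

lemma card_of_lists_infinite:
  assumes "infinite T"
  shows "|lists T| \<le>o |T|"
proof -
  have len: "|{xs \<in> lists T. length xs = n}| \<le>o |T|" for n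
  proof (induction n)
    case 0
    have "{xs \<in> lists T. length xs = 0} = {[]}" by auto
    then show ?case
      using finite_card_of_le_infinite[OF _ assms, of "{[]}"] by simp
  next
    case (Suc n)
    let ?L = "{xs \<in> lists T. length xs = n}"
    have "{xs \<in> lists T. length xs = Suc n} \<subseteq> (\<lambda>(x, xs). x # xs) ` (T \<times> ?L)"
      by (force simp: length_Suc_conv)
    then have "|{xs \<in> lists T. length xs = Suc n}| \<le>o |T \<times> ?L|"
      by (rule ordLeq_transitive[OF card_of_mono1 card_of_image])
    also have "|T \<times> ?L| \<le>o |T|"
      by (rule ordLeq_ordIso_trans[OF card_of_Times_mono2[OF Suc] card_of_Times_same_infinite[OF assms]])
    finally show ?case .
  qed
  have "|\<Union>n. {xs \<in> lists T. length xs = n}| \<le>o |T|"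
    using len iffD1[OF infinite_iff_card_of_nat assms] by (intro card_of_UNION_ordLeq_infinite[OF assms]) blast+
  moreover have "(\<Union>n. {xs \<in> lists T. length xs = n}) = lists T" by auto
  ultimately show ?thesis by simp
qed

text \<open>
  A linear combination is a list of scalar-vector pairs, so over the reals a span is no larger
  than its generating set once that set has at least continuum size.
\<close>

lemma card_of_span_le:
  fixes b :: "'v::real_vector set"
  assumes "|UNIV :: real set| \<le>o |b|"
  shows "|span b| \<le>o |b|"
proof -
  have inf: "infinite b" using card_of_ordLeq_infinite[OF assms infinite_UNIV_char_0] .
  then have inf2: "infinite ((UNIV :: real set) \<times> b)"
    using finite_cartesian_productD2 by blast
  let ?comb = "\<lambda>xs. \<Sum>(r, x)\<leftarrow>xs. r *\<^sub>R (x::'v)"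
  have "span b \<subseteq> ?comb ` lists (UNIV \<times> b)"
  proof
    fix v assume "v \<in> span b"
    then show "v \<in> ?comb ` lists (UNIV \<times> b)"
    proof (induction rule: span_induct_alt)
      case base
      show ?case by (rule image_eqI[of _ _ "[]"]) auto
    next
      case (step c x y)
      then obtain xs where "xs \<in> lists (UNIV \<times> b)" "y = ?comb xs" by blast
      with step show ?case by (intro image_eqI[of _ _ "(c, x) # xs"]) auto
    qed
  qed
  from this have "|span b| \<le>o |lists ((UNIV :: real set) \<times> b)|"
    by (rule ordLeq_transitive[OF card_of_mono1 card_of_image])
  also have "|lists ((UNIV :: real set) \<times> b)| \<le>o |(UNIV :: real set) \<times> b|"
    by (rule card_of_lists_infinite[OF inf2])
  also have "|(UNIV :: real set) \<times> b| \<le>o |b|"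
    by (rule ordIso_imp_ordLeq[OF conjunct2[OF card_of_Times_infinite[OF inf UNIV_not_empty assms]]])
  finally show ?thesis .
qed

text \<open>
  The infinite counterpart of \<open>independent_span_bound\<close>: each element of \<open>S\<close> lies in the span of a
  finite subset of \<open>T\<close>, and each such span contains only finitely many elements of \<open>S\<close>.
\<close>

lemma independent_card_of_le:
  fixes S T :: "'v::real_vector set"
  assumes "independent S" "S \<subseteq> span T" "infinite T"
  shows "|S| \<le>o |T|"
proof -
  have "S \<subseteq> (\<Union>xs\<in>lists T. S \<inter> span (set xs))"
  proof
    fix s assume s: "s \<in> S"
    then have "s \<in> span T" using assms(2) by blast
    then obtain F r where F: "finite F" "F \<subseteq> T" "s = (\<Sum>a\<in>F. r a *\<^sub>R a)"
      unfolding span_explicit by blast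
    obtain xs where xs: "set xs = F" using F(1) finite_list by blast
    moreover have "s \<in> span F"
      unfolding F(3) by (intro span_sum span_scale span_base)
    ultimately show "s \<in> (\<Union>xs\<in>lists T. S \<inter> span (set xs))" using F s by auto
  qed
  then have "|S| \<le>o |\<Union>xs\<in>lists T. S \<inter> span (set xs)|" by (rule card_of_mono1)
  also have "|\<Union>xs\<in>lists T. S \<inter> span (set xs)| \<le>o |T|"
  proof (intro card_of_UNION_ordLeq_infinite ballI)
    fix xs assume "xs \<in> lists T"
    have "finite (S \<inter> span (set xs))"
      using independent_span_bound[of "set xs" "S \<inter> span (set xs)"]
        independent_mono[OF assms(1)] by blast
    then show "|S \<inter> span (set xs)| \<le>o |T|"
      using assms(3) by (rule finite_card_of_le_infinite)
  qed (use assms card_of_lists_infinite in auto)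
  finally show ?thesis .
qed

section \<open>Independent choices and linear functionals\<close>

text \<open>
  By well-founded induction along \<open>r\<close>, every initial segment has an independent image, because it
  is the union of a chain of smaller ones followed by one vector outside their span.
\<close>

lemma independent_wf_image:
  fixes f :: "'i \<Rightarrow> 'v::real_vector"
  assumes wo: "well_order_on D r"
    and nspan: "\<And>d. d \<in> D \<Longrightarrow> f d \<notin> span (f ` underS r d)"
  shows "independent (f ` D)"
proof -
  have r: "wf (r - Id)" "trans r" "antisym r" "total_on D r" "refl_on D r" "r \<subseteq> D \<times> D"
    using wo unfolding order_on_defs by simp_all
  have mono: "under r a \<subseteq> under r b \<or> under r b \<subseteq> under r a" if "a \<in> D" "b \<in> D" for a b
  proof (cases "a = b")
    case False
    then have "(a, b) \<in> r \<or> (b, a) \<in> r" using r(4) that by (auto simp: total_on_def)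
    then show ?thesis unfolding under_def using transD[OF r(2)] by blast
  qed auto
  have chain: "independent (\<Union>a\<in>A. f ` under r a)"
    if "A \<subseteq> D" "\<And>a. a \<in> A \<Longrightarrow> independent (f ` under r a)" for A
  proof (rule independent_Union_directed)
    fix c d assume "c \<in> (\<lambda>a. f ` under r a) ` A" "d \<in> (\<lambda>a. f ` under r a) ` A"
    then obtain a b where ab: "a \<in> A" "b \<in> A" "c = f ` under r a" "d = f ` under r b" by blast
    have "under r a \<subseteq> under r b \<or> under r b \<subseteq> under r a" using ab(1,2) that(1) by (intro mono) auto
    then show "c \<subseteq> d \<or> d \<subseteq> c" unfolding ab(3,4) by (auto simp only: image_mono)
  qed (use that in auto)
  have ind: "d \<in> D \<Longrightarrow> independent (f ` under r d)" for d
  proof (induction d rule: wf_induct_rule[OF r(1)])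
    case (1 d)
    have sub: "underS r d \<subseteq> D" using r(6) by (auto simp: underS_def)
    have "independent (f ` under r a)" if "a \<in> underS r d" for a
      using 1(1)[of a] that sub unfolding underS_def by blast
    then have "independent (\<Union>a\<in>underS r d. f ` under r a)" by (intro chain sub)
    moreover have "(\<Union>a\<in>underS r d. f ` under r a) = f ` underS r d"
    proof -
      have "(\<Union>a\<in>underS r d. under r a) = underS r d"
        unfolding under_def underS_def
        using transD[OF r(2)] antisymD[OF r(3)] refl_onD[OF r(5)] r(6) by blast
      then show ?thesis by (simp only: image_UN[symmetric])
    qed
    ultimately have "independent (insert (f d) (f ` underS r d))"
      using nspan[OF 1(2)] by (simp add: independent_insertI)
    moreover have "insert (f d) (f ` underS r d) = f ` under r d"
      unfolding under_def underS_def using refl_onD[OF r(5)] 1(2) by blast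
    ultimately show ?case by simp
  qed
  have "(\<Union>a\<in>D. f ` under r a) = f ` D"
    unfolding under_def using refl_onD[OF r(5)] r(6) by blast
  then show ?thesis using chain[of D] ind by auto
qed

text \<open>
  Recursion along a well-order of \<open>D\<close> of minimal type: at stage \<open>d\<close> fewer than \<open>|D|\<close> vectors have
  been chosen, so their span cannot contain the at least \<open>|D|\<close> many independent vectors of \<open>Q d\<close>.
\<close>

lemma independent_transversal:
  fixes Q :: "'i \<Rightarrow> 'v::real_vector set"
  assumes big: "\<And>d. d \<in> D \<Longrightarrow> \<exists>b \<subseteq> Q d. independent b \<and> infinite b \<and> |D| \<le>o |b|"
  shows "\<exists>f. (\<forall>d\<in>D. f d \<in> Q d) \<and> independent (f ` D)"
proof -
  let ?r = "card_of D"
  have wo: "well_order_on D ?r" by (rule card_of_well_order_on)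
  then have wf: "wf (?r - Id)" by (simp add: well_order_on_def)
  let ?P = "\<lambda>f d v. d \<in> D \<longrightarrow> v \<in> Q d \<and> v \<notin> span (f ` underS ?r d)"
  have "\<exists>f. \<forall>d. ?P f d (f d)"
  proof (rule dependent_wf_choice[OF wf])
    fix f g :: "'i \<Rightarrow> 'v" and d v
    assume "\<And>z. (z, d) \<in> ?r - Id \<Longrightarrow> f z = g z"
    then have "f ` underS ?r d = g ` underS ?r d"
      by (intro image_cong) (auto simp: underS_def)
    then show "?P f d v = ?P g d v" by simp
  next
    fix d and f :: "'i \<Rightarrow> 'v"
    show "\<exists>v. ?P f d v"
    proof (cases "d \<in> D")
      case True
      obtain b where b: "b \<subseteq> Q d" "independent b" "infinite b" "|D| \<le>o |b|"
        using big[OF True] by blast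
      let ?T = "f ` underS ?r d"
      have "\<not> b \<subseteq> span ?T"
      proof
        assume sub: "b \<subseteq> span ?T"
        have "infinite ?T" using independent_span_bound[OF _ b(2) sub] b(3) by blast
        then have "|b| \<le>o |?T|" by (rule independent_card_of_le[OF b(2) sub])
        also have "|?T| \<le>o |underS ?r d|" by (rule card_of_image)
        also have "|underS ?r d| <o |D|"
          by (rule card_of_underS[OF card_of_Card_order]) (simp only: Field_card_of True)
        finally show False using b(4) not_ordLess_ordLeq by blast
      qed
      then show ?thesis using b(1) by blast
    qed auto
  qed
  then obtain f where "\<And>d. ?P f d (f d)" by blast
  then show ?thesis using independent_wf_image[OF wo, of f] by blast
qed

lemma independent_UN_family:
  fixes E :: "'i \<Rightarrow> 'v::real_vector set"
  assumes indep: "\<And>i. i \<in> I \<Longrightarrow> independent (E i)"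
    and sums: "\<And>J s. finite J \<Longrightarrow> J \<subseteq> I \<Longrightarrow> (\<And>j. j \<in> J \<Longrightarrow> s j \<in> span (E j)) \<Longrightarrow>
      sum s J = 0 \<Longrightarrow> \<forall>j\<in>J. s j = 0"
  shows "independent (\<Union>i\<in>I. E i)"
  unfolding independent_explicit_module
proof (intro allI impI)
  fix t u v
  assume t: "finite t" "t \<subseteq> (\<Union>i\<in>I. E i)" and zero: "(\<Sum>v\<in>t. u v *\<^sub>R v) = 0" and v: "v \<in> t"
  \<comment> \<open>Each term is assigned to one index, so that a vector lying in several \<open>E i\<close> is counted once.\<close>
  define idx where "idx x = (SOME i. i \<in> I \<and> x \<in> E i)" for x
  have idx: "idx x \<in> I" "x \<in> E (idx x)" if "x \<in> t" for x
    using someI_ex[of "\<lambda>i. i \<in> I \<and> x \<in> E i"] t(2) that unfolding idx_def by blast+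
  let ?s = "\<lambda>i. \<Sum>x\<in>{x \<in> t. idx x = i}. u x *\<^sub>R x"
  have "sum ?s (idx ` t) = (\<Sum>v\<in>t. u v *\<^sub>R v)"
    using sum.image_gen[OF t(1), of "\<lambda>v. u v *\<^sub>R v" idx] by simp
  moreover have "?s i \<in> span (E i)" for i
    using idx(2) by (intro span_sum span_scale span_base) auto
  ultimately have "?s (idx v) = 0"
    using sums[of "idx ` t" ?s] t(1) idx(1) zero v by auto
  then show "u v = 0"
    using independentD[OF indep[OF idx(1)[OF v]], of "{x \<in> t. idx x = idx v}" u v] t(1) v idx(2)
    by force
qed

text \<open>
  The dimension count. \<open>Q w\<close> stands for the space of vectors below \<open>w\<close> in a preorder on \<open>N\<close>. If
  \<open>w\<close> is homogeneous (the dimension of \<open>Q v\<close> does not drop for \<open>v\<close> below \<open>w\<close>), then \<open>Q w\<close> has no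
  more elements than each \<open>Q v\<close> has dimensions, so \<open>independent_transversal\<close> applies with \<open>Q w - {0}\<close> as
  index set. Below every vector there is a nonzero vector that is also below some member of a
  maximal family of homogeneous vectors with pairwise disjoint \<open>Q\<close>, so handling that family suffices.
\<close>

lemma linear_functional_nonzero_on_family:
  fixes N :: "'v::real_vector set" and Q :: "'v \<Rightarrow> 'v set"
  assumes sub: "\<And>w. w \<in> N - {0} \<Longrightarrow> subspace (Q w)"
    and self: "\<And>w. w \<in> N - {0} \<Longrightarrow> w \<in> Q w"
    and into: "\<And>w. w \<in> N - {0} \<Longrightarrow> Q w \<subseteq> N"
    and trans: "\<And>v w. w \<in> N - {0} \<Longrightarrow> v \<in> Q w - {0} \<Longrightarrow> Q v \<subseteq> Q w"
    and big: "\<And>w. w \<in> N - {0} \<Longrightarrow> \<exists>b\<subseteq>Q w. independent b \<and> |UNIV :: real set| \<le>o |b|"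
    and sums: "\<And>J s. finite J \<Longrightarrow> J \<subseteq> N - {0} \<Longrightarrow> pairwise (\<lambda>i j. Q i \<inter> Q j = {0}) J \<Longrightarrow>
      (\<And>j. j \<in> J \<Longrightarrow> s j \<in> Q j) \<Longrightarrow> sum s J = 0 \<Longrightarrow> \<forall>j\<in>J. s j = 0"
  shows "\<exists>G :: 'v \<Rightarrow> real. linear G \<and> (\<forall>w\<in>N - {0}. \<exists>v\<in>Q w. G v \<noteq> 0)"
proof -
  have "\<exists>b. b \<subseteq> Q w \<and> independent b \<and> Q w \<subseteq> span b" for w
    using maximal_independent_subset[of "Q w"] by metis
  then obtain bas where bas0: "bas w \<subseteq> Q w" "independent (bas w)" "Q w \<subseteq> span (bas w)" for w
    by metis
  have real_le: "|UNIV :: real set| \<le>o |bas w|" if w: "w \<in> N - {0}" for w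
  proof -
    obtain b where b: "b \<subseteq> Q w" "independent b" "|UNIV :: real set| \<le>o |b|" using big[OF w] by blast
    have "infinite b" using card_of_ordLeq_infinite[OF b(3) infinite_UNIV_char_0] .
    then have "infinite (bas w)"
      using independent_span_bound[of "bas w" b] b bas0(3)[of w] by blast
    then have "|b| \<le>o |bas w|"
      using independent_card_of_le[of b "bas w"] b bas0(3)[of w] by blast
    then show ?thesis using b(3) ordLeq_transitive by blast
  qed
  then have inf: "infinite (bas w)" if "w \<in> N - {0}" for w
    using card_of_ordLeq_infinite[OF _ infinite_UNIV_char_0] that by blast
  have down: "v \<in> N - {0}" if "w \<in> N - {0}" "v \<in> Q w - {0}" for v w
    using into that by blast
  \<comment> \<open>\<open>|bas w|\<close> is the dimension of \<open>Q w\<close>, and by \<open>trans\<close> it can only drop from \<open>w\<close> to \<open>v \<in> Q w\<close>;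
    so the inequality says that it is constant below \<open>w\<close>.\<close>
  define hom where "hom = {w \<in> N - {0}. \<forall>v\<in>Q w - {0}. |bas w| \<le>o |bas v|}"
  have hom_dense: "\<exists>v\<in>hom. v \<in> Q w" if w: "w \<in> N - {0}" for w
  proof -
    have "\<exists>r\<in>(\<lambda>v. |bas v| ) ` (Q w - {0}). \<forall>r'\<in>(\<lambda>v. |bas v| ) ` (Q w - {0}). r \<le>o r'"
      by (rule exists_minim_Card_order) (use self w in \<open>auto simp: card_of_Card_order\<close>)
    then obtain v where v: "v \<in> Q w - {0}" "\<And>u. u \<in> Q w - {0} \<Longrightarrow> |bas v| \<le>o |bas u|" by auto
    have "v \<in> hom" unfolding hom_def using v down[OF w v(1)] trans[OF w v(1)] by blast
    then show ?thesis using v(1) by blast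
  qed
  have "\<exists>E\<subseteq>Q w. independent E \<and> (\<forall>v\<in>Q w - {0}. E \<inter> Q v \<noteq> {})" if "w \<in> hom" for w
  proof -
    have w: "w \<in> N - {0}" "\<And>v. v \<in> Q w - {0} \<Longrightarrow> |bas w| \<le>o |bas v|"
      using that unfolding hom_def by auto
    let ?D = "Q w - {0}"
    have "|?D| \<le>o |span (bas w)|" using bas0(3)[of w] by (intro card_of_mono1) blast
    also have "|span (bas w)| \<le>o |bas w|" by (rule card_of_span_le[OF real_le[OF w(1)]])
    finally have D: "|?D| \<le>o |bas w|" .
    have "\<exists>f. (\<forall>d\<in>?D. f d \<in> Q d) \<and> independent (f ` ?D)"
    proof (rule independent_transversal)
      fix d assume d: "d \<in> ?D"
      then show "\<exists>b\<subseteq>Q d. independent b \<and> infinite b \<and> |?D| \<le>o |b|"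
        using bas0 inf[OF down[OF w(1) d]] ordLeq_transitive[OF D w(2)[OF d]] by blast
    qed
    then obtain f where f: "\<And>d. d \<in> ?D \<Longrightarrow> f d \<in> Q d" "independent (f ` ?D)" by blast
    show ?thesis
      using f trans[OF w(1)] by (intro exI[of _ "f ` ?D"]) blast
  qed
  then obtain E where E: "\<And>w. w \<in> hom \<Longrightarrow> E w \<subseteq> Q w" "\<And>w. w \<in> hom \<Longrightarrow> independent (E w)"
      "\<And>v w. w \<in> hom \<Longrightarrow> v \<in> Q w - {0} \<Longrightarrow> E w \<inter> Q v \<noteq> {}"
    by metis
  let ?R = "\<lambda>i j. Q i \<inter> Q j = {0}"
  have "\<exists>A\<in>{A. A \<subseteq> hom \<and> pairwise ?R A}. \<forall>X\<in>{A. A \<subseteq> hom \<and> pairwise ?R A}. A \<subseteq> X \<longrightarrow> X = A"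
  proof (rule subset_Zorn')
    fix C assume C: "subset.chain {A. A \<subseteq> hom \<and> pairwise ?R A} C"
    then have "pairwise ?R (\<Union>C)"
      by (intro pairwise_chain_Union) (auto simp: subset_chain_def chain_subset_def)
    then show "\<Union>C \<in> {A. A \<subseteq> hom \<and> pairwise ?R A}" using C by (auto simp: subset_chain_def)
  qed
  then obtain A where A: "A \<subseteq> hom" "pairwise ?R A"
    and max: "\<And>X. X \<subseteq> hom \<Longrightarrow> pairwise ?R X \<Longrightarrow> A \<subseteq> X \<Longrightarrow> X = A"
    by auto
  have homN: "hom \<subseteq> N - {0}" by (auto simp: hom_def)
  have "independent (\<Union>i\<in>A. E i)"
  proof (rule independent_UN_family)
    fix J s assume J: "finite J" "J \<subseteq> A" "\<And>j. j \<in> J \<Longrightarrow> s j \<in> span (E j)" "sum s J = 0"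
    have "s j \<in> Q j" if "j \<in> J" for j
      using J(2,3) that A(1) homN E(1)[of j] sub[of j] span_minimal[of "E j" "Q j"] by blast
    then show "\<forall>j\<in>J. s j = 0"
      using J A homN by (intro sums[of J s]) (auto intro: pairwise_subset)
  qed (use E(2) A(1) in blast)
  then obtain G :: "'v \<Rightarrow> real" where G: "linear G" "\<And>x. x \<in> (\<Union>i\<in>A. E i) \<Longrightarrow> G x = 1"
    using linear_independent_extend[of "\<Union>i\<in>A. E i" "\<lambda>_. 1::real"] by blast
  have "\<exists>v\<in>Q w. G v \<noteq> 0" if w: "w \<in> N - {0}" for w
  proof -
    obtain v where v: "v \<in> hom" "v \<in> Q w" using hom_dense[OF w] by blast
    have vN: "v \<in> N - {0}" using v homN by blast
    \<comment> \<open>Otherwise maximality puts \<open>v\<close> itself into \<open>A\<close>, but \<open>Q v\<close> contains \<open>v\<close>.\<close>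
    have "\<exists>i\<in>A. Q v \<inter> Q i \<noteq> {0}"
    proof (rule ccontr)
      assume no: "\<not> ?thesis"
      then have "pairwise ?R (insert v A)"
        using A(2) by (auto simp: pairwise_insert Int_commute)
      then have "v \<in> A" using max[of "insert v A"] A(1) v(1) by blast
      then show False using no self[OF vN] vN by blast
    qed
    then obtain i where i: "i \<in> A" "Q v \<inter> Q i \<noteq> {0}" by blast
    have iN: "i \<in> N - {0}" using i(1) A(1) homN by blast
    have "0 \<in> Q v \<inter> Q i" using sub[OF vN] sub[OF iN] subspace_0 by blast
    then obtain u where u: "u \<in> Q v - {0}" "u \<in> Q i - {0}" using i(2) by blast
    \<comment> \<open>\<open>E i\<close> meets \<open>Q u\<close> for every \<open>u\<close> below \<open>i\<close>, in particular for one that is also below \<open>v\<close>.\<close>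
    obtain e where e: "e \<in> E i" "e \<in> Q u" using E(3)[of i u] i(1) A(1) u(2) by blast
    have "e \<in> Q w" using e(2) trans[OF vN u(1)] trans[OF w, of v] v(2) vN by blast
    moreover have "G e = 1" using G(2) e(1) i(1) by blast
    ultimately show ?thesis by (intro bexI[of _ e]) auto
  qed
  then show ?thesis using G(1) by blast
qed

lemma linear_projection_with_kernel:
  fixes M :: "'v::real_vector set"
  assumes "subspace M"
  shows "\<exists>P :: 'v \<Rightarrow> 'v. linear P \<and> (\<forall>m\<in>M. P m = 0) \<and> (\<forall>v. v - P v \<in> M)"
proof -
  obtain B where B: "B \<subseteq> M" "independent B" "M \<subseteq> span B"
    by (rule maximal_independent_subset[of M])
  obtain C where C: "B \<subseteq> C" "independent C" "UNIV \<subseteq> span C"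
    by (rule maximal_independent_subset_extend[OF subset_UNIV B(2)])
  obtain P :: "'v \<Rightarrow> 'v" where P: "linear P" "\<And>x. x \<in> C \<Longrightarrow> P x = (if x \<in> B then 0 else x)"
    using linear_independent_extend[OF C(2), of "\<lambda>x. if x \<in> B then 0 else x"] by blast
  have "P m = 0" if "m \<in> M" for m
  proof (rule linear_eq_0_on_span[OF P(1)])
    show "m \<in> span B" using that B(3) by blast
  qed (use P(2) C(1) in auto)
  moreover have "v - P v \<in> M" for v
  proof -
    have "v \<in> span C" using C(3) by blast
    then show ?thesis
    proof (induction rule: span_induct_alt)
      case base
      show ?case using linear_0[OF P(1)] subspace_0[OF assms] by simp
    next
      case (step c x y)
      have "x - P x \<in> M" using P(2)[OF step(1)] B(1) subspace_0[OF assms] by auto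
      then have "c *\<^sub>R (x - P x) + (y - P y) \<in> M"
        using step(2) assms by (intro subspace_add subspace_scale)
      then show ?case
        by (simp add: linear_add[OF P(1)] linear_scale[OF P(1)] algebra_simps)
    qed
  qed
  ultimately show ?thesis using P(1) by blast
qed

text \<open>
  The result \<open>linear_functional_nonzero_on_family\<close> modulo \<open>U 0\<close>. A linear projection \<open>P\<close> with
  kernel \<open>U 0\<close> plays the part of the quotient map: as every \<open>U f\<close> contains \<open>U 0\<close>, the space \<open>U f\<close> and its image under \<open>P\<close> determine
  each other.
\<close>

lemma linear_functional_nonzero_on_lower_sets:
  fixes U :: "'v::real_vector \<Rightarrow> 'v set"
  assumes sub: "\<And>f. subspace (U f)"
    and refl: "\<And>f. f \<in> U f"
    and trans: "\<And>f g. g \<in> U f \<Longrightarrow> U g \<subseteq> U f"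
    and big: "\<And>f. f \<notin> U 0 \<Longrightarrow> \<exists>e :: real \<Rightarrow> 'v. range e \<subseteq> U f \<and>
      (\<forall>T u. finite T \<longrightarrow> (\<Sum>t\<in>T. u t *\<^sub>R e t) \<in> U 0 \<longrightarrow> (\<forall>t\<in>T. u t = 0))"
    and sums: "\<And>J s. finite J \<Longrightarrow> pairwise (\<lambda>i j. U i \<inter> U j \<subseteq> U 0) J \<Longrightarrow>
      (\<And>j. j \<in> J \<Longrightarrow> s j \<in> U j) \<Longrightarrow> sum s J \<in> U 0 \<Longrightarrow> \<forall>j\<in>J. s j \<in> U 0"
  shows "\<exists>F :: 'v \<Rightarrow> real. linear F \<and> (\<forall>f\<in>U 0. F f = 0) \<and> (\<forall>f. f \<notin> U 0 \<longrightarrow> (\<exists>h\<in>U f. F h \<noteq> 0))"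
proof -
  obtain P :: "'v \<Rightarrow> 'v" where P: "linear P" "\<And>m. m \<in> U 0 \<Longrightarrow> P m = 0" "\<And>v. v - P v \<in> U 0"
    using linear_projection_with_kernel[OF sub] by blast
  have U0: "U 0 \<subseteq> U f" for f by (rule trans[OF subspace_0[OF sub]])
  have P_in: "P v \<in> U f" if "v \<in> U f" for v f
    using subspace_diff[OF sub that subsetD[OF U0 P(3)[of v]]] by simp
  have in_P: "v \<in> U f" if "P v \<in> U f" for v f
    using subspace_add[OF sub that subsetD[OF U0 P(3)[of v]]] by simp
  have U_P: "U (P v) = U v" for v
    using trans[OF P_in[OF refl]] trans[OF in_P[OF refl]] by blast
  have PP: "P (P v) = P v" for v
    using P(2)[OF P(3)[of v]] by (simp add: linear_diff[OF P(1)])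
  have N: "P w = w" "w \<notin> U 0" if "w \<in> range P - {0}" for w
    using that PP P(2)[of w] by auto
  define Q where "Q w = P ` U w" for w
  have "\<exists>G :: 'v \<Rightarrow> real. linear G \<and> (\<forall>w\<in>range P - {0}. \<exists>v\<in>Q w. G v \<noteq> 0)"
  proof (rule linear_functional_nonzero_on_family)
    show "subspace (Q w)" for w
      unfolding Q_def by (rule linear_subspace_image[OF P(1) sub])
    show "w \<in> Q w" if "w \<in> range P - {0}" for w
      unfolding Q_def using N(1)[OF that] refl by (metis imageI)
    show "Q w \<subseteq> range P" for w by (auto simp: Q_def)
    show "Q v \<subseteq> Q w" if "v \<in> Q w - {0}" for v w
      using that trans[OF P_in] unfolding Q_def by blast
    show "\<exists>b\<subseteq>Q w. independent b \<and> |UNIV :: real set| \<le>o |b|" if w: "w \<in> range P - {0}" for w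
    proof -
      obtain e :: "real \<Rightarrow> 'v" where e: "range e \<subseteq> U w"
        "\<And>T u. finite T \<Longrightarrow> (\<Sum>t\<in>T. u t *\<^sub>R e t) \<in> U 0 \<Longrightarrow> \<forall>t\<in>T. u t = 0"
        using big[OF N(2)[OF w]] by blast
      have lin: "(\<Sum>t\<in>T. u t *\<^sub>R e t) \<in> U 0" if "(\<Sum>t\<in>T. u t *\<^sub>R P (e t)) = 0" for T u
      proof (rule in_P)
        have "P (\<Sum>t\<in>T. u t *\<^sub>R e t) = (\<Sum>t\<in>T. u t *\<^sub>R P (e t))"
          by (simp only: linear_sum[OF P(1)] linear_scale[OF P(1)])
        then show "P (\<Sum>t\<in>T. u t *\<^sub>R e t) \<in> U 0" using that subspace_0[OF sub] by simp
      qed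
      have inj: "inj (\<lambda>t. P (e t))"
      proof (rule injI, rule ccontr)
        fix s t assume st: "P (e s) = P (e t)" "s \<noteq> t"
        then have "(\<Sum>r\<in>{s, t}. (if r = s then 1 else -1) *\<^sub>R P (e r)) = 0" by simp
        from e(2)[OF _ lin[OF this]] show False by auto
      qed
      have "independent (range (\<lambda>t. P (e t)))"
        unfolding independent_explicit_module
      proof (intro allI impI)
        fix t u v
        assume t: "finite t" "t \<subseteq> range (\<lambda>t. P (e t))" "(\<Sum>v\<in>t. u v *\<^sub>R v) = 0" "v \<in> t"
        obtain T where T: "finite T" "t = (\<lambda>t. P (e t)) ` T"
          using finite_subset_image[OF t(1,2)] by blast
        have "(\<Sum>r\<in>T. u (P (e r)) *\<^sub>R P (e r)) = 0"
          using t(3) unfolding T(2) by (subst (asm) sum.reindex) (auto intro: inj_on_subset[OF inj])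
        then have "\<forall>r\<in>T. u (P (e r)) = 0" by (rule e(2)[OF T(1) lin])
        then show "u v = 0" using t(4) T(2) by blast
      qed
      moreover have "|UNIV :: real set| \<le>o |range (\<lambda>t. P (e t))|"
        using inj card_of_ordLeq[of "UNIV :: real set" "range (\<lambda>t. P (e t))"] by blast
      moreover have "range (\<lambda>t. P (e t)) \<subseteq> Q w" using e(1) by (auto simp: Q_def)
      ultimately show ?thesis by blast
    qed
    show "\<forall>j\<in>J. s j = 0"
      if J: "finite J" "J \<subseteq> range P - {0}" "pairwise (\<lambda>i j. Q i \<inter> Q j = {0}) J"
        "\<And>j. j \<in> J \<Longrightarrow> s j \<in> Q j" "sum s J = 0" for J s
    proof -
      have "pairwise (\<lambda>i j. U i \<inter> U j \<subseteq> U 0) J"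
      proof (rule pairwise_mono[OF J(3)])
        fix i j assume ij: "Q i \<inter> Q j = {0}"
        show "U i \<inter> U j \<subseteq> U 0"
        proof
          fix x assume "x \<in> U i \<inter> U j"
          then have "P x \<in> Q i \<inter> Q j" by (auto simp: Q_def)
          then have "P x = 0" using ij by blast
          then show "x \<in> U 0" using in_P[of x 0] subspace_0[OF sub, of 0] by simp
        qed
      qed simp
      moreover have "s j \<in> U j" if "j \<in> J" for j using J(4)[OF that] P_in by (auto simp: Q_def)
      ultimately have "\<forall>j\<in>J. s j \<in> U 0" using J(1,5) subspace_0[OF sub, of 0] by (intro sums) simp_all
      then have "P (s j) = 0" if "j \<in> J" for j using P(2) that by blast
      moreover have "P (s j) = s j" if "j \<in> J" for j using J(4)[OF that] PP by (auto simp: Q_def)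
      ultimately show ?thesis by simp
    qed
  qed
  then obtain G :: "'v \<Rightarrow> real"
    where G: "linear G" "\<And>w. w \<in> range P - {0} \<Longrightarrow> \<exists>v\<in>Q w. G v \<noteq> 0" by blast
  have "\<exists>h\<in>U f. (G \<circ> P) h \<noteq> 0" if "f \<notin> U 0" for f
  proof -
    have "P f \<in> range P - {0}" using that in_P[of f 0] subspace_0[OF sub] by auto
    from G(2)[OF this] show ?thesis by (auto simp: Q_def U_P)
  qed
  moreover have "linear (G \<circ> P)" using P(1) G(1) by (rule linear_compose)
  moreover have "(G \<circ> P) f = 0" if "f \<in> U 0" for f using P(2)[OF that] linear_0[OF G(1)] by simp
  ultimately show ?thesis by blast
qed

section \<open>Domination of continuous functions along a filter\<close>

text \<open>
  Functions bounded on each set \<open>{\<bar>f\<bar> \<le> k}\<close>, locally with respect to the filter. Unlike inclusion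
  of supports, this relation does not change when \<open>f\<close> or \<open>h\<close> is altered by a function that is
  eventually bounded.
\<close>

definition dominated :: "'a::topological_space filter \<Rightarrow> 'a cfun \<Rightarrow> 'a cfun set" where
  "dominated \<Phi> f = {h. \<forall>k. \<exists>C. \<forall>\<^sub>F x in \<Phi>. \<bar>cf_app f x\<bar> \<le> k \<longrightarrow> \<bar>cf_app h x\<bar> \<le> C}"

lemma dominated_zero_iff: "h \<in> dominated \<Phi> 0 \<longleftrightarrow> (\<exists>C. \<forall>\<^sub>F x in \<Phi>. \<bar>cf_app h x\<bar> \<le> C)"
proof
  assume "h \<in> dominated \<Phi> 0"
  then have "\<exists>C. \<forall>\<^sub>F x in \<Phi>. \<bar>cf_app 0 x\<bar> \<le> 0 \<longrightarrow> \<bar>cf_app h x\<bar> \<le> C"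
    unfolding dominated_def by blast
  then show "\<exists>C. \<forall>\<^sub>F x in \<Phi>. \<bar>cf_app h x\<bar> \<le> C" by (simp add: zero_cfun.rep_eq)
next
  assume "\<exists>C. \<forall>\<^sub>F x in \<Phi>. \<bar>cf_app h x\<bar> \<le> C"
  then obtain C where "\<forall>\<^sub>F x in \<Phi>. \<bar>cf_app h x\<bar> \<le> C" by blast
  then have "\<forall>\<^sub>F x in \<Phi>. \<bar>cf_app 0 x\<bar> \<le> k \<longrightarrow> \<bar>cf_app h x\<bar> \<le> C" for k :: real
    by (rule eventually_mono) blast
  then show "h \<in> dominated \<Phi> 0" unfolding dominated_def by blast
qed

lemma subspace_dominated: "subspace (dominated \<Phi> f)"
  unfolding subspace_def
proof (intro conjI ballI allI)
  show "0 \<in> dominated \<Phi> f"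
    unfolding dominated_def by (intro CollectI allI exI[of _ 0]) (simp add: zero_cfun.rep_eq)
next
  fix g h assume gh: "g \<in> dominated \<Phi> f" "h \<in> dominated \<Phi> f"
  have "\<exists>C. \<forall>\<^sub>F x in \<Phi>. \<bar>cf_app f x\<bar> \<le> k \<longrightarrow> \<bar>cf_app (g + h) x\<bar> \<le> C" for k
  proof -
    obtain C D where "\<forall>\<^sub>F x in \<Phi>. \<bar>cf_app f x\<bar> \<le> k \<longrightarrow> \<bar>cf_app g x\<bar> \<le> C"
      "\<forall>\<^sub>F x in \<Phi>. \<bar>cf_app f x\<bar> \<le> k \<longrightarrow> \<bar>cf_app h x\<bar> \<le> D"
      using gh unfolding dominated_def by blast
    then have "\<forall>\<^sub>F x in \<Phi>. \<bar>cf_app f x\<bar> \<le> k \<longrightarrow> \<bar>cf_app (g + h) x\<bar> \<le> C + D"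
      by eventually_elim (auto simp: plus_cfun.rep_eq)
    then show ?thesis by blast
  qed
  then show "g + h \<in> dominated \<Phi> f" unfolding dominated_def by blast
next
  fix c h assume h: "h \<in> dominated \<Phi> f"
  have "\<exists>C. \<forall>\<^sub>F x in \<Phi>. \<bar>cf_app f x\<bar> \<le> k \<longrightarrow> \<bar>cf_app (c *\<^sub>R h) x\<bar> \<le> C" for k
  proof -
    obtain C where "\<forall>\<^sub>F x in \<Phi>. \<bar>cf_app f x\<bar> \<le> k \<longrightarrow> \<bar>cf_app h x\<bar> \<le> C"
      using h unfolding dominated_def by blast
    then have "\<forall>\<^sub>F x in \<Phi>. \<bar>cf_app f x\<bar> \<le> k \<longrightarrow> \<bar>cf_app (c *\<^sub>R h) x\<bar> \<le> \<bar>c\<bar> * C"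
      by eventually_elim (auto simp: scaleR_cfun.rep_eq abs_mult intro: mult_left_mono)
    then show ?thesis by blast
  qed
  then show "c *\<^sub>R h \<in> dominated \<Phi> f" unfolding dominated_def by blast
qed

lemma dominated_refl: "f \<in> dominated \<Phi> f"
  unfolding dominated_def by (intro CollectI allI, rule exI, rule always_eventually) blast

lemma dominated_trans:
  assumes "g \<in> dominated \<Phi> f"
  shows "dominated \<Phi> g \<subseteq> dominated \<Phi> f"
proof
  fix h assume h: "h \<in> dominated \<Phi> g"
  have "\<exists>C. \<forall>\<^sub>F x in \<Phi>. \<bar>cf_app f x\<bar> \<le> k \<longrightarrow> \<bar>cf_app h x\<bar> \<le> C" for k
  proof -
    obtain D where D: "\<forall>\<^sub>F x in \<Phi>. \<bar>cf_app f x\<bar> \<le> k \<longrightarrow> \<bar>cf_app g x\<bar> \<le> D"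
      using assms unfolding dominated_def by blast
    obtain C where "\<forall>\<^sub>F x in \<Phi>. \<bar>cf_app g x\<bar> \<le> D \<longrightarrow> \<bar>cf_app h x\<bar> \<le> C"
      using h unfolding dominated_def by blast
    with D have "\<forall>\<^sub>F x in \<Phi>. \<bar>cf_app f x\<bar> \<le> k \<longrightarrow> \<bar>cf_app h x\<bar> \<le> C"
      by eventually_elim blast
    then show ?thesis by blast
  qed
  then show "h \<in> dominated \<Phi> f" unfolding dominated_def by blast
qed

lift_definition min_abs :: "'a::topological_space cfun \<Rightarrow> 'a cfun \<Rightarrow> 'a cfun"
  is "\<lambda>f g x. min \<bar>f x\<bar> \<bar>g x\<bar>"
  by (intro continuous_intros)

text \<open>
  The common lower bound that makes disjointness usable: if nothing unbounded is dominated by both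
  \<open>f\<close> and \<open>g\<close>, then for two functions dominated by \<open>f\<close> and by \<open>g\<close>, respectively, the pointwise minimum of the
  absolute values is bounded.
\<close>

lemma min_abs_dominated:
  assumes "g \<in> dominated \<Phi> f \<or> h \<in> dominated \<Phi> f"
  shows "min_abs g h \<in> dominated \<Phi> f"
proof -
  have "min_abs g h \<in> dominated \<Phi> u" if "u = g \<or> u = h" for u
    unfolding dominated_def
  proof (intro CollectI allI)
    fix k
    show "\<exists>C. \<forall>\<^sub>F x in \<Phi>. \<bar>cf_app u x\<bar> \<le> k \<longrightarrow> \<bar>cf_app (min_abs g h) x\<bar> \<le> C"
      by (rule exI[of _ k], rule always_eventually) (use that in \<open>auto simp: min_abs.rep_eq\<close>)
  qed
  then show ?thesis using assms dominated_trans by blast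
qed

text \<open>
  At any point where one \<open>s f\<close> exceeds the common bound \<open>C\<close> for the minima of pairs, all other
  summands are at most \<open>C\<close> in absolute value there and so cannot cancel it; hence a bounded sum has
  bounded summands.
\<close>

lemma dominated_disjoint_sums:
  fixes s :: "'a::topological_space cfun \<Rightarrow> 'a cfun"
  assumes J: "finite J"
    and disj: "pairwise (\<lambda>f g. dominated \<Phi> f \<inter> dominated \<Phi> g \<subseteq> dominated \<Phi> 0) J"
    and s: "\<And>f. f \<in> J \<Longrightarrow> s f \<in> dominated \<Phi> f"
    and sum: "sum s J \<in> dominated \<Phi> 0"
  shows "\<forall>f\<in>J. s f \<in> dominated \<Phi> 0"
proof -
  have app: "cf_app (sum s I) x = (\<Sum>f\<in>I. cf_app (s f) x)" for I x
    by (induction I rule: infinite_finite_induct) (auto simp: zero_cfun.rep_eq plus_cfun.rep_eq)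
  obtain K where K: "\<forall>\<^sub>F x in \<Phi>. \<bar>cf_app (sum s J) x\<bar> \<le> K"
    using sum unfolding dominated_zero_iff by blast
  have "\<exists>C. \<forall>\<^sub>F x in \<Phi>. \<bar>min \<bar>cf_app (s f) x\<bar> \<bar>cf_app (s g) x\<bar>\<bar> \<le> C"
    if "f \<in> J" "g \<in> J" "f \<noteq> g" for f g
  proof -
    have "min_abs (s f) (s g) \<in> dominated \<Phi> f \<inter> dominated \<Phi> g"
      using min_abs_dominated s that by blast
    then have "min_abs (s f) (s g) \<in> dominated \<Phi> 0"
      using disj that unfolding pairwise_def by blast
    then show ?thesis unfolding dominated_zero_iff min_abs.rep_eq .
  qed
  then obtain c where c: "\<And>f g. f \<in> J \<Longrightarrow> g \<in> J \<Longrightarrow> f \<noteq> g \<Longrightarrow>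
      \<forall>\<^sub>F x in \<Phi>. \<bar>min \<bar>cf_app (s f) x\<bar> \<bar>cf_app (s g) x\<bar>\<bar> \<le> c f g" by metis
  \<comment> \<open>A sum of absolute values bounds all \<open>c f g\<close> at once, also if \<open>J\<close> is empty.\<close>
  define C where "C = (\<Sum>f\<in>J. \<Sum>g\<in>J. \<bar>c f g\<bar>)"
  have cC: "c f g \<le> C" if "f \<in> J" "g \<in> J" for f g
  proof -
    have "c f g \<le> \<bar>c f g\<bar>" by simp
    also have "\<dots> \<le> (\<Sum>g\<in>J. \<bar>c f g\<bar>)" using J that by (intro member_le_sum) auto
    also have "\<dots> \<le> C" unfolding C_def
      using J that by (intro member_le_sum[of f J "\<lambda>f. \<Sum>g\<in>J. \<bar>c f g\<bar>"]) (auto intro: sum_nonneg)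
    finally show ?thesis .
  qed
  have "\<forall>\<^sub>F x in \<Phi>. \<forall>f\<in>J. \<forall>g\<in>J. f \<noteq> g \<longrightarrow> min \<bar>cf_app (s f) x\<bar> \<bar>cf_app (s g) x\<bar> \<le> C"
  proof (intro eventually_ball_finite[OF J] ballI)
    fix f g assume fg: "f \<in> J" "g \<in> J"
    show "\<forall>\<^sub>F x in \<Phi>. f \<noteq> g \<longrightarrow> min \<bar>cf_app (s f) x\<bar> \<bar>cf_app (s g) x\<bar> \<le> C"
    proof (cases "f = g")
      case False
      from c[OF fg False] show ?thesis
        by (rule eventually_mono) (use cC[OF fg] in linarith)
    qed simp
  qed
  with K have ev: "\<forall>\<^sub>F x in \<Phi>. \<forall>f\<in>J. \<bar>cf_app (s f) x\<bar> \<le> \<bar>C\<bar> + K + real (card J) * \<bar>C\<bar>"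
  proof eventually_elim
    case (elim x)
    have K0: "0 \<le> K" using elim(1) by linarith
    show ?case
    proof
      fix f assume f: "f \<in> J"
      show "\<bar>cf_app (s f) x\<bar> \<le> \<bar>C\<bar> + K + real (card J) * \<bar>C\<bar>"
      proof (cases "\<bar>cf_app (s f) x\<bar> \<le> \<bar>C\<bar>")
        case True
        then show ?thesis using K0 by (simp add: add_increasing2)
      next
        case False
        have "\<bar>\<Sum>g\<in>J - {f}. cf_app (s g) x\<bar> \<le> (\<Sum>g\<in>J - {f}. \<bar>cf_app (s g) x\<bar>)" by (rule sum_abs)
        also have "\<dots> \<le> (\<Sum>g\<in>J - {f}. \<bar>C\<bar>)"
        proof (rule sum_mono)
          fix g assume g: "g \<in> J - {f}"
          then have "f \<noteq> g \<longrightarrow> min \<bar>cf_app (s f) x\<bar> \<bar>cf_app (s g) x\<bar> \<le> C"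
            by (intro bspec[OF bspec[OF elim(2) f]]) simp
          then have "min \<bar>cf_app (s f) x\<bar> \<bar>cf_app (s g) x\<bar> \<le> C" using g by blast
          then show "\<bar>cf_app (s g) x\<bar> \<le> \<bar>C\<bar>" using False by linarith
        qed
        also have "\<dots> \<le> real (card J) * \<bar>C\<bar>"
          using card_Diff1_le[of J f] by (auto intro!: mult_right_mono)
        finally have "\<bar>\<Sum>g\<in>J - {f}. cf_app (s g) x\<bar> \<le> real (card J) * \<bar>C\<bar>" .
        moreover have "cf_app (sum s J) x = cf_app (s f) x + (\<Sum>g\<in>J - {f}. cf_app (s g) x)"
          unfolding app using J f by (rule sum.remove)
        ultimately show ?thesis using elim(1) by linarith
      qed
    qed
  qed
  show ?thesis
  proof
    fix f assume "f \<in> J"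
    with ev show "s f \<in> dominated \<Phi> 0"
      unfolding dominated_zero_iff by (intro exI) (rule eventually_mono, assumption, blast)
  qed
qed

lift_definition exp_abs :: "real \<Rightarrow> 'a::topological_space cfun \<Rightarrow> 'a cfun"
  is "\<lambda>t f x. exp (exp t * \<bar>f x\<bar>)"
  by (intro continuous_intros)

lemma exp_abs_dominated: "exp_abs t f \<in> dominated \<Phi> f"
  unfolding dominated_def
proof (intro CollectI allI)
  fix k
  show "\<exists>C. \<forall>\<^sub>F x in \<Phi>. \<bar>cf_app f x\<bar> \<le> k \<longrightarrow> \<bar>cf_app (exp_abs t f) x\<bar> \<le> C"
    by (rule exI[of _ "exp (exp t * k)"]) (simp add: exp_abs.rep_eq)
qed

lemma exp_sum_at_top:
  fixes u :: "real \<Rightarrow> real"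
  assumes T: "finite T" "T \<noteq> {}" and u: "\<And>t. t \<in> T \<Longrightarrow> u t \<noteq> 0"
  shows "filterlim (\<lambda>y. \<bar>\<Sum>t\<in>T. u t * exp (exp t * y)\<bar>) at_top at_top"
proof -
  define m where "m = Max T"
  have m: "m \<in> T" "\<And>t. t \<in> T \<Longrightarrow> t \<le> m" using T by (auto simp: m_def)
  \<comment> \<open>After division by the fastest exponential only its coefficient survives in the limit.\<close>
  have lim: "((\<lambda>y. u t * exp ((exp t - exp m) * y)) \<longlongrightarrow> (if t = m then u m else 0)) at_top"
    if t: "t \<in> T" for t
  proof (cases "t = m")
    case False
    then have "exp t - exp m < 0" using m(2)[OF t] by simp
    then have "filterlim (\<lambda>y. (exp t - exp m) * y) at_bot at_top"
      by (intro filterlim_tendsto_neg_mult_at_bot[OF tendsto_const _ filterlim_ident])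
    then have "((\<lambda>y. exp ((exp t - exp m) * y)) \<longlongrightarrow> 0) at_top"
      by (rule filterlim_compose[OF exp_at_bot])
    then show ?thesis using False tendsto_mult_right_zero by auto
  qed simp
  have "((\<lambda>y. \<Sum>t\<in>T. u t * exp ((exp t - exp m) * y)) \<longlongrightarrow> (\<Sum>t\<in>T. if t = m then u m else 0)) at_top"
    using lim by (rule tendsto_sum)
  then have "((\<lambda>y. \<bar>\<Sum>t\<in>T. u t * exp ((exp t - exp m) * y)\<bar>) \<longlongrightarrow> \<bar>u m\<bar>) at_top"
    using T m(1) by (intro tendsto_rabs) (simp add: sum.delta')
  moreover have "filterlim (\<lambda>y. exp (exp m * y)) at_top at_top"
    by (rule filterlim_compose[OF exp_at_top])
      (rule filterlim_tendsto_pos_mult_at_top[OF tendsto_const _ filterlim_ident], simp)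
  ultimately have "filterlim (\<lambda>y. \<bar>\<Sum>t\<in>T. u t * exp ((exp t - exp m) * y)\<bar> * exp (exp m * y)) at_top at_top"
    using u[OF m(1)] by (intro filterlim_tendsto_pos_mult_at_top) auto
  moreover have "\<bar>\<Sum>t\<in>T. u t * exp ((exp t - exp m) * y)\<bar> * exp (exp m * y) =
      \<bar>\<Sum>t\<in>T. u t * exp (exp t * y)\<bar>" for y
  proof -
    have "(\<Sum>t\<in>T. u t * exp (exp t * y)) = (\<Sum>t\<in>T. u t * exp ((exp t - exp m) * y)) * exp (exp m * y)"
      unfolding sum_distrib_right
      by (rule sum.cong) (simp_all add: mult.assoc left_diff_distrib flip: exp_add)
    then show ?thesis by (simp add: abs_mult)
  qed
  ultimately show ?thesis by simp
qed

text \<open>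
  A nontrivial combination of exponentials with distinct rates tends to infinity in absolute value
  with its argument, the fastest rate winning. So it can be bounded along the filter only if its
  argument \<open>\<bar>f\<bar>\<close> is. The rates \<open>exp t\<close> are positive and indexed by all reals \<open>t\<close>, which gives
  continuum many independent vectors.
\<close>

lemma exp_abs_independent:
  assumes f: "f \<notin> dominated \<Phi> 0" and T: "finite T"
    and bdd: "(\<Sum>t\<in>T. u t *\<^sub>R exp_abs t f) \<in> dominated \<Phi> 0"
  shows "\<forall>t\<in>T. u t = 0"
proof (rule ccontr)
  assume no: "\<not> ?thesis"
  let ?S = "{t \<in> T. u t \<noteq> 0}"
  let ?p = "\<lambda>y. \<Sum>t\<in>?S. u t * exp (exp t * y)"
  have app: "cf_app (\<Sum>t\<in>I. u t *\<^sub>R exp_abs t f) x = (\<Sum>t\<in>I. u t * exp (exp t * \<bar>cf_app f x\<bar>))" for I x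
    by (induction I rule: infinite_finite_induct)
      (auto simp: zero_cfun.rep_eq plus_cfun.rep_eq scaleR_cfun.rep_eq exp_abs.rep_eq)
  have p: "cf_app (\<Sum>t\<in>T. u t *\<^sub>R exp_abs t f) x = ?p \<bar>cf_app f x\<bar>" for x
    unfolding app using T by (intro sum.mono_neutral_right) auto
  obtain C where C: "\<forall>\<^sub>F x in \<Phi>. \<bar>?p \<bar>cf_app f x\<bar>\<bar> \<le> C"
    using bdd unfolding dominated_zero_iff p by blast
  have "filterlim (\<lambda>y. \<bar>?p y\<bar>) at_top at_top"
    using T no by (intro exp_sum_at_top) auto
  then have "\<forall>\<^sub>F y in at_top. C < \<bar>?p y\<bar>" by (simp add: filterlim_at_top_dense)
  then obtain k where k: "\<And>y. k \<le> y \<Longrightarrow> C < \<bar>?p y\<bar>" unfolding eventually_at_top_linorder by blast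
  from C have "\<forall>\<^sub>F x in \<Phi>. \<bar>cf_app f x\<bar> \<le> k"
  proof (rule eventually_mono)
    fix x assume "\<bar>?p \<bar>cf_app f x\<bar>\<bar> \<le> C"
    then show "\<bar>cf_app f x\<bar> \<le> k" using k[of "\<bar>cf_app f x\<bar>"] by linarith
  qed
  then show False using f unfolding dominated_zero_iff by blast
qed

text \<open>
  Domination satisfies all requirements of \<open>linear_functional_nonzero_on_lower_sets\<close>, with the eventually
  bounded functions as the space \<open>U 0\<close>.
\<close>

theorem functional_detecting_unbounded:
  fixes \<Phi> :: "'a::topological_space filter"
  shows "\<exists>F :: 'a cfun \<Rightarrow> real. linear F \<and> (\<forall>f\<in>dominated \<Phi> 0. F f = 0) \<and>
    (\<forall>f. f \<notin> dominated \<Phi> 0 \<longrightarrow> (\<exists>h\<in>dominated \<Phi> f. F h \<noteq> 0))"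
proof (rule linear_functional_nonzero_on_lower_sets)
  fix f :: "'a cfun" assume f: "f \<notin> dominated \<Phi> 0"
  show "\<exists>e :: real \<Rightarrow> 'a cfun. range e \<subseteq> dominated \<Phi> f \<and> (\<forall>T u. finite T \<longrightarrow>
      (\<Sum>t\<in>T. u t *\<^sub>R e t) \<in> dominated \<Phi> 0 \<longrightarrow> (\<forall>t\<in>T. u t = (0::real)))"
    using exp_abs_dominated[of _ f \<Phi>] exp_abs_independent[OF f]
    by (intro exI[of _ "\<lambda>t. exp_abs t f"] conjI allI impI image_subsetI)
qed (rule subspace_dominated dominated_refl dominated_trans dominated_disjoint_sums; assumption)+

section \<open>Functions near a set and the two dual spaces\<close>

definition near :: "'a::metric_space set \<Rightarrow> 'a filter" where
  "near A = (INF \<delta>\<in>{0<..}. principal (enlargement A \<delta>))"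

lemma eventually_near: "eventually P (near A) \<longleftrightarrow> (\<exists>\<delta>>0. \<forall>x\<in>enlargement A \<delta>. P x)"
  unfolding near_def
proof (subst eventually_INF_base)
  fix a b :: real assume "a \<in> {0<..}" "b \<in> {0<..}"
  then show "\<exists>x\<in>{0<..}. principal (enlargement A x) \<le>
      inf (principal (enlargement A a)) (principal (enlargement A b))"
    using enlargement_mono[OF order_refl, of _ _ A] by (intro bexI[of _ "min a b"]) auto
qed (auto simp: eventually_principal)

lemma abs_lt_of_rho_lt:
  assumes "rho B f < ennreal r" "x \<in> B"
  shows "\<bar>cf_app f x\<bar> < r"
proof -
  have "ennreal \<bar>cf_app f x\<bar> \<le> rho B f" unfolding rho_def using assms(2) by (rule SUP_upper)
  then have "ennreal \<bar>cf_app f x\<bar> < ennreal r" using assms(1) by (rule order_le_less_trans)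
  then show ?thesis by (simp add: ennreal_less_iff)
qed

lemma bounded_near_of_rho_s_lt:
  assumes "rho_s A f < ennreal r"
  shows "f \<in> dominated (near A) 0"
proof -
  obtain \<delta> where \<delta>: "\<delta> > 0" "rho (enlargement A \<delta>) f < ennreal r"
    using assms unfolding rho_s_eq INF_less_iff by auto
  then show ?thesis
    unfolding dominated_zero_iff eventually_near
    using abs_lt_of_rho_lt[OF \<delta>(2)] less_imp_le by blast
qed

text \<open>
  Translation by the neighborhood \<open>{f. rho_s A f < 1}\<close> of \<open>0\<close> leaves \<open>F\<close> unchanged, so the preimage of
  any set is open.
\<close>

lemma vanishing_in_dual_tau_s:
  assumes bor: "bornology \<B>" and A: "A \<in> \<B>" and F: "linear F"
    and zero: "\<And>f. f \<in> dominated (near A) 0 \<Longrightarrow> F f = 0"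
  shows "F \<in> dual (tau_s \<B>)"
proof -
  let ?V = "{f. rho_s A f < ennreal 1}"
  have "?V \<in> {{f. rho_s B f < ennreal r} | B r. B \<in> \<B> \<and> 0 < r}"
    using A by (intro CollectI exI[of _ A] exI[of _ 1]) auto
  moreover have "F (f + v) = F f" if "v \<in> ?V" for f v
    using that zero[OF bounded_near_of_rho_s_lt[of A v 1]] linear_add[OF F] by simp
  ultimately have "openin (tau_s \<B>) {f. F f \<in> S}" for S
    unfolding tau_s_def openin_transl_topology[OF nhd_filter_base_rho_s[OF bor]]
    by (intro ballI bexI[of _ ?V]) simp_all
  then show ?thesis
    unfolding dual_def continuous_map using F by (simp add: topspace_tau_s[OF bor])
qed

text \<open>
  On the functions vanishing on \<open>B\<close>, all scalar multiples stay in the neighborhood where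
  \<open>\<bar>F\<bar> < 1\<close>, so \<open>F\<close> vanishes there.
\<close>

lemma dual_tau_supported:
  assumes bor: "bornology \<B>" and F: "F \<in> dual (tau \<B>)"
  shows "\<exists>B\<in>\<B>. \<forall>f. (\<forall>x\<in>B. cf_app f x = 0) \<longrightarrow> F f = 0"
proof -
  have lin: "linear F" and cont: "continuous_map (tau \<B>) euclideanreal F"
    using F by (auto simp: dual_def)
  have "openin (tau \<B>) {f. F f \<in> {-1<..<1}}"
    using openin_continuous_map_preimage[OF cont, of "{-1<..<1}"]
    by (simp add: topspace_tau[OF bor] del: greaterThanLessThan_iff)
  then have "\<exists>U. openin (tau \<B>) U \<and> 0 \<in> U \<and> U \<subseteq> {f. F f \<in> {-1<..<1}}"
    using linear_0[OF lin] by (intro exI[of _ "{f. F f \<in> {-1<..<1}}"]) simp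
  then obtain B r where B: "B \<in> \<B>" "r > 0" "{f. rho B f < ennreal r} \<subseteq> {f. F f \<in> {-1<..<1}}"
    unfolding tau_nhd_base[OF bor] by blast
  have "F f = 0" if f: "\<forall>x\<in>B. cf_app f x = 0" for f
  proof (rule ccontr)
    assume nz: "F f \<noteq> 0"
    let ?g = "(1 / F f) *\<^sub>R f"
    have "rho B ?g \<le> ennreal 0"
      unfolding rho_def using f by (intro SUP_least) (simp add: scaleR_cfun.rep_eq)
    also have "ennreal 0 < ennreal r" using B(2) by (simp add: ennreal_less_iff)
    finally have "F ?g \<in> {-1<..<1}" using B(3) by blast
    then show False using nz by (simp add: linear_scale[OF lin])
  qed
  then show ?thesis using B(1) by blast
qed

text \<open>
  Take a closed \<open>C\<close> that is disjoint from \<open>B\<close> but meets every enlargement of \<open>A\<close>. The Urysohn quotient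
  that is \<open>0\<close> on \<open>B\<close> and \<open>1\<close> on \<open>C\<close> is divided by \<open>infdist x A + infdist x C\<close>. This is positive since
  \<open>A \<subseteq> B\<close>, and on \<open>C\<close> it is the distance to \<open>A\<close>, which takes arbitrarily small values there.
\<close>

lemma unshielded_unbounded_function:
  fixes A B :: "'a::metric_space set"
  assumes A: "A \<noteq> {}" "A \<subseteq> B" and B: "closed B" and no: "\<not> shield B A"
  shows "\<exists>f. (\<forall>x\<in>B. cf_app f x = 0) \<and> f \<notin> dominated (near A) 0"
proof -
  have "\<not> (\<forall>C. C \<noteq> {} \<and> closed C \<and> C \<inter> B = {} \<longrightarrow> (\<exists>\<delta>>0. C \<inter> enlargement A \<delta> = {}))"
    using no A(2) by (simp only: shield_def simp_thms)
  then obtain C where "(C \<noteq> {} \<and> closed C \<and> C \<inter> B = {}) \<and> \<not> (\<exists>\<delta>>0. C \<inter> enlargement A \<delta> = {})"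
    by (simp only: not_all not_imp) (elim exE, rule that)
  then have C: "C \<noteq> {}" "closed C" "C \<inter> B = {}" "\<And>\<delta>. \<delta> > 0 \<Longrightarrow> C \<inter> enlargement A \<delta> \<noteq> {}"
    by auto
  have B_ne: "B \<noteq> {}" using A by blast
  have posBC: "infdist x B + infdist x C > 0" for x
  proof -
    have "infdist x B \<noteq> 0 \<or> infdist x C \<noteq> 0"
      using in_closed_iff_infdist_zero[OF B B_ne] in_closed_iff_infdist_zero[OF C(2,1)] C(3) by blast
    then show ?thesis using infdist_nonneg[of x B] infdist_nonneg[of x C] by linarith
  qed
  have posAC: "infdist x A + infdist x C > 0" for x
  proof -
    have "infdist x B \<le> infdist x A" using A by (rule infdist_mono[rotated])
    then show ?thesis using posBC[of x] by linarith
  qed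
  let ?f = "\<lambda>x. infdist x B / (infdist x B + infdist x C) / (infdist x A + infdist x C)"
  have "continuous_on UNIV ?f"
    using less_imp_neq[OF posBC] less_imp_neq[OF posAC] by (intro continuous_intros) metis+
  then have f: "cf_app (Cfun ?f) = ?f" by (simp add: Cfun_inverse)
  have "Cfun ?f \<notin> dominated (near A) 0"
  proof
    assume "Cfun ?f \<in> dominated (near A) 0"
    then obtain K \<delta> where K: "\<delta> > 0" "\<And>x. x \<in> enlargement A \<delta> \<Longrightarrow> \<bar>?f x\<bar> \<le> K"
      unfolding dominated_zero_iff eventually_near f by blast
    \<comment> \<open>On \<open>C\<close> within distance \<open>\<epsilon>\<close> of \<open>A\<close> the function is larger than \<open>\<bar>K\<bar> + 1\<close>.\<close>
    define \<epsilon> where "\<epsilon> = min \<delta> (1 / (\<bar>K\<bar> + 1))"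
    have \<epsilon>: "\<epsilon> > 0" "\<epsilon> \<le> \<delta>" "\<epsilon> \<le> 1 / (\<bar>K\<bar> + 1)" using K(1) by (auto simp: \<epsilon>_def)
    obtain x where x: "x \<in> C" "x \<in> enlargement A \<epsilon>" using C(4)[OF \<epsilon>(1)] by blast
    obtain a where a: "a \<in> A" "dist x a < \<epsilon>" using x(2) by (auto simp: enlargement_def)
    have dA: "infdist x A < 1 / (\<bar>K\<bar> + 1)" using infdist_le[OF a(1), of x] a(2) \<epsilon>(3) by linarith
    have xC: "infdist x C = 0" using x(1) by simp
    have "?f x = 1 / infdist x A" using posBC[of x] xC by simp
    moreover have "1 / infdist x A > \<bar>K\<bar> + 1"
      using dA posAC[of x] xC by (simp add: field_simps)
    moreover have "\<bar>?f x\<bar> \<le> K" using K(2) x(2) enlargement_mono[OF order_refl \<epsilon>(2)] by blast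
    ultimately show False by linarith
  qed
  moreover have "\<forall>x\<in>B. cf_app (Cfun ?f) x = 0" unfolding f by simp
  ultimately show ?thesis by blast
qed

text \<open>
  On \<open>B\<close> and near \<open>A\<close> one has \<open>f = 0\<close>, so \<open>h\<close> is bounded there, say by \<open>C\<close>. Subtracting from \<open>h\<close> its
  truncation at height \<open>C\<close> therefore gives zero on that part of \<open>B\<close>, and a cutoff function that is \<open>1\<close>
  close to \<open>A\<close> removes the rest.
\<close>

lemma dominated_approx_vanishing:
  fixes A B :: "'a::metric_space set"
  assumes A: "A \<noteq> {}" and f: "\<forall>x\<in>B. cf_app f x = 0" and h: "h \<in> dominated (near A) f"
  shows "\<exists>g. (\<forall>x\<in>B. cf_app g x = 0) \<and> h - g \<in> dominated (near A) 0"
proof -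
  obtain C \<delta> where C: "\<delta> > 0" "\<And>x. x \<in> enlargement A \<delta> \<Longrightarrow> \<bar>cf_app f x\<bar> \<le> 0 \<Longrightarrow> \<bar>cf_app h x\<bar> \<le> C"
    using h unfolding dominated_def eventually_near by blast
  let ?c = "\<lambda>x. min 1 (max 0 (2 - 2 / \<delta> * infdist x A))"
  let ?t = "\<lambda>x. max (- \<bar>C\<bar>) (min \<bar>C\<bar> (cf_app h x))"
  let ?g = "\<lambda>x. ?c x * (cf_app h x - ?t x)"
  have "continuous_on UNIV (cf_app h)" using cf_app[of h] by simp
  then have "continuous_on UNIV ?g" by (intro continuous_intros)
  then have g: "cf_app (Cfun ?g) = ?g" by (simp add: Cfun_inverse)
  have zero: "?g x = 0" if x: "x \<in> B" for x
  proof (cases "x \<in> enlargement A \<delta>")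
    case True
    then have "\<bar>cf_app h x\<bar> \<le> C" using C(2) f x by simp
    then have "?t x = cf_app h x" by linarith
    then show ?thesis by simp
  next
    case False
    then have "\<delta> \<le> dist x a" if "a \<in> A" for a using that by (auto simp: enlargement_def not_less)
    then have "\<delta> \<le> infdist x A" using A by (simp add: infdist_notempty cINF_greatest)
    then have "2 - 2 / \<delta> * infdist x A \<le> 0" using C(1) by (simp add: field_simps)
    then have "?c x = 0" by simp
    then show ?thesis by simp
  qed
  have "\<bar>cf_app (h - Cfun ?g) x\<bar> \<le> \<bar>C\<bar>" if x: "x \<in> enlargement A (\<delta> / 2)" for x
  proof -
    obtain a where a: "a \<in> A" "dist x a < \<delta> / 2" using x by (auto simp: enlargement_def)
    have "infdist x A < \<delta> / 2" using infdist_le[OF a(1), of x] a(2) by linarith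
    then have "1 \<le> 2 - 2 / \<delta> * infdist x A" using C(1) by (simp add: field_simps)
    then have "?c x = 1" by simp
    then have "cf_app (Cfun ?g) x = cf_app h x - ?t x" by (simp only: g mult_1)
    then have "cf_app (h - Cfun ?g) x = cf_app h x - (cf_app h x - ?t x)"
      by (simp only: minus_cfun.rep_eq)
    then have "cf_app (h - Cfun ?g) x = ?t x" by linarith
    then show ?thesis by linarith
  qed
  then have "h - Cfun ?g \<in> dominated (near A) 0"
    unfolding dominated_zero_iff eventually_near
    using half_gt_zero[OF C(1)] by (intro exI[of _ "\<bar>C\<bar>"] exI[of _ "\<delta> / 2"] conjI ballI)
  moreover have "\<forall>x\<in>B. cf_app (Cfun ?g) x = 0" unfolding g using zero by (intro ballI)
  ultimately show ?thesis by (intro exI[of _ "Cfun ?g"] conjI)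
qed

lemma shielded_of_dual_subset:
  fixes \<B> \<B>0 :: "'a::metric_space set set"
  assumes bor: "bornology \<B>" and base: "closed_base \<B>0 \<B>"
    and dual: "dual (tau_s \<B>) \<subseteq> dual (tau \<B>)"
  shows "shielded_from_closed \<B>"
  unfolding shielded_from_closed_def
proof (rule ballI, rule ccontr)
  fix A assume A: "A \<in> \<B>" and no: "\<not> (\<exists>A1\<in>\<B>. closed A1 \<and> shield A1 A)"
  have A_ne: "A \<noteq> {}" using A bor by (auto simp: bornology_def)
  obtain F :: "'a cfun \<Rightarrow> real" where F: "linear F" "\<And>f. f \<in> dominated (near A) 0 \<Longrightarrow> F f = 0"
    "\<And>f. f \<notin> dominated (near A) 0 \<Longrightarrow> \<exists>h\<in>dominated (near A) f. F h \<noteq> 0"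
    using functional_detecting_unbounded[of "near A"] by blast
  have "F \<in> dual (tau \<B>)" using vanishing_in_dual_tau_s[OF bor A F(1,2)] dual by blast
  then obtain B where B: "B \<in> \<B>" "\<And>f. (\<forall>x\<in>B. cf_app f x = 0) \<Longrightarrow> F f = 0"
    using dual_tau_supported[OF bor] by blast
  \<comment> \<open>\<open>A\<close> is adjoined so that the closed set is a superset of \<open>A\<close> and could be a shield of it.\<close>
  have "A \<union> B \<in> \<B>" using bor A B(1) by (simp add: bornology_def)
  then obtain B0 where B0: "B0 \<in> \<B>" "closed B0" "A \<union> B \<subseteq> B0"
    using base unfolding closed_base_def by blast
  obtain f where f: "\<forall>x\<in>B0. cf_app f x = 0" "f \<notin> dominated (near A) 0"
    using unshielded_unbounded_function[OF A_ne, of B0] B0 no by blast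
  obtain h where h: "h \<in> dominated (near A) f" "F h \<noteq> 0" using F(3)[OF f(2)] by blast
  obtain g where g: "\<forall>x\<in>B0. cf_app g x = 0" "h - g \<in> dominated (near A) 0"
    using dominated_approx_vanishing[OF A_ne f(1) h(1)] by blast
  have "F g = 0" using B(2) g(1) B0(3) by blast
  moreover have "F h - F g = 0" using F(2)[OF g(2)] by (simp add: linear_diff[OF F(1)])
  ultimately show False using h(2) by simp
qed

section \<open>Shields give equal topologies\<close>

lemma transl_topology_mono:
  assumes "nhd_filter_base N" "nhd_filter_base N'" "\<And>V. V \<in> N \<Longrightarrow> \<exists>W\<in>N'. W \<subseteq> V"
    and "openin (transl_topology N) U"
  shows "openin (transl_topology N') U"
  unfolding openin_transl_topology[OF assms(2)]
proof
  fix f assume "f \<in> U"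
  then obtain V where "V \<in> N" "\<forall>v\<in>V. f + v \<in> U"
    using assms(4) unfolding openin_transl_topology[OF assms(1)] by blast
  then show "\<exists>V\<in>N'. \<forall>v\<in>V. f + v \<in> U" using assms(3)[of V] by blast
qed

lemma rho_le_rho_s: "rho B f \<le> rho_s B f"
  unfolding rho_s_eq by (intro INF_greatest rho_mono) (auto simp: enlargement_def)

text \<open>
  The shield is applied to the closed set \<open>{\<bar>f\<bar> \<ge> r / 2}\<close>; outside it the
  supremum of \<open>\<bar>f\<bar>\<close> is only known to be at most \<open>r / 2\<close>, whence the halving.
\<close>

lemma rho_s_less_of_shield:
  assumes sh: "shield A1 A" and r: "0 < r" and f: "rho A1 f < ennreal (r / 2)"
  shows "rho_s A f < ennreal r"
proof -
  let ?C = "{x. r / 2 \<le> \<bar>cf_app f x\<bar>}"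
  have "continuous_on UNIV (cf_app f)" using cf_app[of f] by simp
  then have "closed ?C" by (intro closed_Collect_le continuous_intros)
  moreover have "?C \<inter> A1 = {}" using abs_lt_of_rho_lt[OF f] by fastforce
  ultimately have "\<exists>\<delta>>0. ?C \<inter> enlargement A \<delta> = {}"
    using sh unfolding shield_def by (cases "?C = {}") (auto intro: exI[of _ 1])
  then obtain \<delta> where \<delta>: "\<delta> > 0" "?C \<inter> enlargement A \<delta> = {}" by blast
  have "rho_s A f \<le> rho (enlargement A \<delta>) f" unfolding rho_s_eq using \<delta>(1) by (intro INF_lower) simp
  also have "\<dots> \<le> ennreal (r / 2)"
    unfolding rho_def using \<delta>(2) by (intro SUP_least ennreal_leI) force
  also have "\<dots> < ennreal r" using r by (simp add: ennreal_less_iff)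
  finally show ?thesis .
qed

lemma tau_eq_tau_s_of_shielded:
  assumes bor: "bornology \<B>" and sh: "shielded_from_closed \<B>"
  shows "tau \<B> = tau_s \<B>"
  unfolding topology_eq tau_def tau_s_def
proof (intro allI iffI)
  let ?N = "{{f. rho B f < ennreal r} | B r. B \<in> \<B> \<and> 0 < r}"
  let ?Ns = "{{f. rho_s B f < ennreal r} | B r. B \<in> \<B> \<and> 0 < r}"
  note N = nhd_filter_base_rho[OF bor] and Ns = nhd_filter_base_rho_s[OF bor]
  fix U
  show "openin (transl_topology ?Ns) U" if U: "openin (transl_topology ?N) U"
  proof (rule transl_topology_mono[OF N Ns _ U])
    fix V assume "V \<in> ?N"
    then obtain B r where B: "B \<in> \<B>" "0 < r" "V = {f. rho B f < ennreal r}" by blast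
    then have "{f. rho_s B f < ennreal r} \<subseteq> V" using rho_le_rho_s order_le_less_trans by blast
    then show "\<exists>W\<in>?Ns. W \<subseteq> V" using B(1,2) by blast
  qed
  show "openin (transl_topology ?N) U" if U: "openin (transl_topology ?Ns) U"
  proof (rule transl_topology_mono[OF Ns N _ U])
    fix V assume "V \<in> ?Ns"
    then obtain A r where A: "A \<in> \<B>" "0 < r" "V = {f. rho_s A f < ennreal r}" by blast
    obtain A1 where A1: "A1 \<in> \<B>" "shield A1 A"
      using sh A(1) unfolding shielded_from_closed_def by blast
    have "{f. rho A1 f < ennreal (r / 2)} \<subseteq> V"
      using rho_s_less_of_shield[OF A1(2) A(2)] A(3) by blast
    moreover have "{f. rho A1 f < ennreal (r / 2)} \<in> ?N" using A1(1) half_gt_zero[OF A(2)] by blast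
    ultimately show "\<exists>W\<in>?N. W \<subseteq> V" by blast
  qed
qed

theorem theorem3p3:
  fixes \<B> \<B>0 :: "'a::metric_space set set"
  assumes "bornology \<B>" and "closed_base \<B>0 \<B>"
  shows "(tau \<B> = tau_s \<B> \<longleftrightarrow> shielded_from_closed \<B>) \<and>
         (shielded_from_closed \<B> \<longleftrightarrow> dual (tau \<B>) = dual (tau_s \<B>))"
  using shielded_of_dual_subset[OF assms] tau_eq_tau_s_of_shielded[OF assms(1)] by auto

end
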